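(* Let $K$ be a compact line. A family $(F_i)_{i\in I}$ in $\mathrm{NBV}(K)$ is weak*-null if and only if all of the following hold: (a) $(F_i)_{i\in I}$ is bounded in $\mathrm{NBV}(K)$; (b) $\lim_{i\in I}F_i(t)=0$ for all $t\in K^+$; (c) there exists $k\ge0$ such that $\sum_{t\in S}|F_i(t)|\le k\mod c_0(I)$ for every finite subset $S$ of $K$.
   Context: A compact line is a totally ordered set which is compact in its order topology. For $F:K\to\mathbb R$, $V(F)$ is the supremum over finite $t_0<\dots<t_n$ in $K$ of $\sum_j|F(t_{j+1})-F(t_j)|$ and $\Vert F\Vert_{\mathrm{BV}}=|F(\min K)|+V(F)$; $\mathrm{NBV}(K)$ is the Banach space of right-continuous maps of bounded variation with this norm. Each finite signed regular Borel measure $\mu$ on $K$ corresponds isometrically to $F_\mu(t)=\mu([\min K,t])\in\mathrm{NBV}(K)$, and this identifies $C(K)^*$ with $\mathrm{NBV}(K)$. For real families, $\lim_{i\in I}a_i=0$ means $\{i:|a_i|\ge\varepsilon\}$ is finite for each $\varepsilon>0$; $c_0(I)$ is the set of such families. $(F_i)_{i\in I}$ is weak*-null if $\lim_{i\in I}\int_Kf\,d\mu_i=0$ for all $f\in C(K)$, $\mu_i$ the measure with $F_{\mu_i}=F_i$. $K^+$ is the set of right-isolated points of $K$: $t=\max K$ or there is $s>t$ with $]t,s[=\emptyset$. For real families $(x_i),(y_i)$, "$x_i\le y_i\mod c_0(I)$" means there is $(z_i)\in c_0(I)$ with $x_i\le y_i+z_i$ for all $i$, i.e. $\{i:x_i\ge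 y_i+\varepsilon\}$ is finite for every $\varepsilon>0$. *)

theory Defs
  imports "HOL-Probability.Probability"
begin

definition compact_line :: "'a::linorder_topology itself \<Rightarrow> bool" where
  "compact_line _ \<longleftrightarrow> compact (UNIV :: 'a set)"

definition kmin :: "'a::linorder" where
  "kmin = (LEAST t. True)"

definition c0_null :: "'i set \<Rightarrow> ('i \<Rightarrow> real) \<Rightarrow> bool" where
  "c0_null I a \<longleftrightarrow> (\<forall>\<epsilon>>0. finite {i\<in>I. \<bar>a i\<bar> \<ge> \<epsilon>})"

definition le_mod_c0 :: "'i set \<Rightarrow> ('i \<Rightarrow> real) \<Rightarrow> ('i \<Rightarrow> real) \<Rightarrow> bool" where
  "le_mod_c0 I x y \<longleftrightarrow> (\<forall>\<epsilon>>0. finite {i\<in>I. x i \<ge> y i + \<epsilon>})"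

definition variation_sums :: "('a::linorder \<Rightarrow> real) \<Rightarrow> real set" where
  "variation_sums F = {(\<Sum>j<n. \<bar>F (t (Suc j)) - F (t j)\<bar>) | t n. \<forall>j<n. t j < t (Suc j)}"

definition bounded_variation :: "('a::linorder \<Rightarrow> real) \<Rightarrow> bool" where
  "bounded_variation F \<longleftrightarrow> bdd_above (variation_sums F)"

definition variation :: "('a::linorder \<Rightarrow> real) \<Rightarrow> real" where
  "variation F = Sup (variation_sums F)"

definition nbv_norm :: "('a::linorder \<Rightarrow> real) \<Rightarrow> real" where
  "nbv_norm F = \<bar>F kmin\<bar> + variation F"

definition right_continuous :: "('a::linorder_topology \<Rightarrow> real) \<Rightarrow> bool" where
  "right_continuous F \<longleftrightarrow> (\<forall>t. (F \<longlongrightarrow> F t) (at_right t))"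

definition NBV :: "('a::linorder_topology \<Rightarrow> real) set" where
  "NBV = {F. bounded_variation F \<and> right_continuous F}"

definition right_isolated :: "'a::linorder \<Rightarrow> bool" where
  "right_isolated t \<longleftrightarrow> (\<forall>s. \<not> t < s) \<or> (\<exists>s>t. {t<..<s} = {})"

definition regular_borel_measure :: "'a::topological_space measure \<Rightarrow> bool" where
  "regular_borel_measure M \<longleftrightarrow> sets M = sets borel \<and> finite_measure M \<and>
     (\<forall>A\<in>sets borel.
        emeasure M A = (INF U\<in>{U. open U \<and> A \<subseteq> U}. emeasure M U) \<and>
        emeasure M A = (SUP C\<in>{C. compact C \<and> C \<subseteq> A}. emeasure M C))"

text \<open>A finite signed regular Borel measure is given as a difference P - N of
  finite positive regular Borel measures; it corresponds to F when
  F t = (P - N)([min K, t]) for all t.\<close>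
definition represents :: "('a::linorder_topology \<Rightarrow> real) \<Rightarrow> 'a measure \<Rightarrow> 'a measure \<Rightarrow> bool" where
  "represents F P N \<longleftrightarrow> regular_borel_measure P \<and> regular_borel_measure N \<and>
     (\<forall>t. F t = measure P {kmin..t} - measure N {kmin..t})"

definition weak_star_null :: "'i set \<Rightarrow> ('i \<Rightarrow> 'a::linorder_topology \<Rightarrow> real) \<Rightarrow> bool" where
  "weak_star_null I F \<longleftrightarrow> (\<exists>P N. (\<forall>i\<in>I. represents (F i) (P i) (N i)) \<and>
     (\<forall>f::'a \<Rightarrow> real. continuous_on UNIV f \<longrightarrow>
        c0_null I (\<lambda>i. integral\<^sup>L (P i) f - integral\<^sup>L (N i) f)))"

end

theory Submission
  imports Defs
begin

text \<open>For \<open>F\<close> in \<open>NBV\<close> and continuous \<open>f\<close>, approximate \<open>f\<close> uniformly by a step function that is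
  constant on half-open intervals \<open>{t j<..t (Suc j)}\<close>. Summation by parts turns the integral into
  a sum of the values \<open>F (t j)\<close> weighted by jumps of the step function. At points that are not
  right-isolated these jumps are small by continuity, so (c) controls their contribution, while (b)
  controls the right-isolated points and (a) the approximation error.

  Conversely, (a) is uniform boundedness and (b) tests against indicators of clopen intervals. For
  (c), let \<open>f s\<close> be continuous, equal to 1 up to \<open>s\<close> and to 0 from the next point of \<open>S\<close> on. The
  integrals of \<open>f s\<close> tend to 0, and \<open>F s\<close> differs from the integral by at most the variation of
  \<open>F\<close> between \<open>s\<close> and the next point; these variations add up to at most \<open>nbv_norm F\<close>.\<close>

subsection \<open>Regular measures from monotone functions\<close>

text \<open>Weak*-nullity asks for some representing pair \<open>P\<close>, \<open>N\<close>, and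
  this shapes both directions. For sufficiency the pair has to be built, together with its
  regularity, on a line that may be neither metrizable nor second countable; its total mass must be
  at most a fixed multiple of the norm, because the approximation error is an oscillation times that
  mass. For necessity the pair is arbitrary: \<open>P\<close> and \<open>N\<close> may share a large
  common part, so the norm of \<open>F\<close> does not control their masses. Bounds there are
  proved for one fixed pair, with an error proportional to its mass that is sent to 0 before
  anything uniform in \<open>i\<close> is claimed. Cells are left-open and right-closed throughout
  because \<open>F t\<close> measures \<open>{kmin..t}\<close>, so that \<open>F b - F a\<close> is
  the signed mass of \<open>{a<..b}\<close>.\<close>

text \<open>The sets that can be squeezed between a closed and an open set with arbitrarily small
  gap form a sigma-algebra, so it is enough to squeeze open sets. The induction follows the
  generation of the Borel sets.\<close>

lemma closed_open_approx:
  fixes M :: "'a::topological_space measure"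
  assumes fin: "finite_measure M" and sets_M: "sets M = sets borel"
    and inner: "\<And>U e. open U \<Longrightarrow> 0 < e \<Longrightarrow> \<exists>C. closed C \<and> C \<subseteq> U \<and> measure M (U - C) < e"
    and A: "A \<in> sets borel" and "0 < e"
  shows "\<exists>C U. closed C \<and> open U \<and> C \<subseteq> A \<and> A \<subseteq> U \<and> measure M (U - C) < e"
proof -
  interpret finite_measure M by (rule fin)
  note sets_M [simp]
  have A': "A \<in> sigma_sets UNIV {S. open S}"
    using A by (simp add: borel_def)
  then show ?thesis using \<open>0 < e\<close>
  proof (induction arbitrary: e)
    case (Basic U)
    then show ?case using inner[of U e] by auto
  next
    case Empty
    then show ?case by (intro exI[of _ "{}"]) auto
  next
    case (Compl A)
    from Compl.IH[OF Compl.prems] obtain C U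
      where "closed C" "open U" "C \<subseteq> A" "A \<subseteq> U" "measure M (U - C) < e" by blast
    moreover have "- C - (- U) = U - C" by auto
    ultimately show ?case
      by (intro exI[of _ "- U"] exI[of _ "- C"]) (auto simp: closed_def)
  next
    case (Union A)
    \<comment> \<open>Half of \<open>e\<close> is divided geometrically among the gaps
      \<open>U n - C n\<close>; the other half pays for the truncation to
      \<open>D n\<close>.\<close>
    have "\<exists>C U. closed C \<and> open U \<and> C \<subseteq> A n \<and> A n \<subseteq> U \<and> measure M (U - C) < e/2 * (1/2)^Suc n" for n
      using Union.IH[of "e/2 * (1/2)^Suc n" n] Union.prems by simp
    then obtain C U where CU: "\<And>n. closed (C n)" "\<And>n. open (U n)" "\<And>n. C n \<subseteq> A n" "\<And>n. A n \<subseteq> U n"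
      "\<And>n. measure M (U n - C n) < e/2 * (1/2)^Suc n" by metis
    have [measurable]: "C n \<in> sets borel" "U n \<in> sets borel" for n
      using CU by auto
    have geo: "(\<lambda>n. e/2 * (1/2)^Suc n) sums (e/2 * 1)"
      by (intro sums_mult power_half_series)
    have summ: "summable (\<lambda>n. measure M (U n - C n))"
      using CU(5) by (intro summable_comparison_test'[OF sums_summable[OF geo], of 0]) (auto intro: less_imp_le)
    have "measure M (\<Union>n. U n - C n) \<le> (\<Sum>n. measure M (U n - C n))"
      by (intro finite_measure_subadditive_countably summ) auto
    also have "\<dots> \<le> (\<Sum>n. e/2 * (1/2)^Suc n)"
      using CU(5) by (intro suminf_le summ sums_summable[OF geo]) (auto intro: less_imp_le)
    also have "\<dots> = e/2"
      using sums_unique[OF geo] by simp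
    finally have 1: "measure M (\<Union>n. U n - C n) \<le> e/2" .
    \<comment> \<open>The full union of the \<open>C n\<close> need not be closed; by continuity
      from below, a finite stage loses less than \<open>e/2\<close>.\<close>
    define D where "D n = (\<Union>k\<le>n. C k)" for n
    have D_meas: "D n \<in> sets borel" for n
      unfolding D_def by (intro sets.finite_UN) auto
    have "incseq D"
      unfolding D_def by (intro monoI UN_mono) auto
    then have "(\<lambda>n. measure M (D n)) \<longlonglongrightarrow> measure M (\<Union>n. D n)"
      using D_meas by (intro finite_Lim_measure_incseq) auto
    from tendstoD[OF this, of "e/2"]
    have "\<forall>\<^sub>F n in sequentially. \<bar>measure M (D n) - measure M (\<Union>n. D n)\<bar> < e/2"
      using Union.prems by (simp add: dist_real_def)
    then obtain n where n: "\<bar>measure M (D n) - measure M (\<Union>n. D n)\<bar> < e/2"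
      by (auto simp: eventually_sequentially)
    have UD: "(\<Union>n. D n) = (\<Union>n. C n)"
      by (auto simp: D_def)
    have 2: "measure M ((\<Union>n. C n) - D n) < e/2"
    proof -
      have "measure M ((\<Union>n. D n) - D n) = measure M (\<Union>n. D n) - measure M (D n)"
        using D_meas by (intro finite_measure_Diff) auto
      then show ?thesis using n unfolding UD by linarith
    qed
    have "measure M ((\<Union>n. U n) - D n) \<le> measure M ((\<Union>n. U n - C n) \<union> ((\<Union>n. C n) - D n))"
      using D_meas by (intro finite_measure_mono) auto
    also have "\<dots> \<le> measure M (\<Union>n. U n - C n) + measure M ((\<Union>n. C n) - D n)"
      using D_meas by (intro measure_Un_le) auto
    also have "\<dots> < e" using 1 2 by simp
    finally have "measure M ((\<Union>n. U n) - D n) < e" .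
    moreover have "closed (D n)"
      unfolding D_def using CU(1) by (intro closed_UN) auto
    moreover have "D n \<subseteq> (\<Union>n. A n)"
      using CU(3) by (auto simp: D_def)
    moreover have "open (\<Union>n. U n)" "(\<Union>n. A n) \<subseteq> (\<Union>n. U n)"
      using CU(2,4) by (auto intro!: open_UN)
    ultimately show ?case by blast
  qed
qed

text \<open>Closed subsets of a compact space are compact, and finiteness turns a small gap
  \<open>U - C\<close> around \<open>A\<close> into the outer and the inner estimate at
  once.\<close>

lemma regular_borel_measureI:
  fixes M :: "'a::topological_space measure"
  assumes K: "compact (UNIV :: 'a set)"
    and fin: "finite_measure M" and sets_M: "sets M = sets borel"
    and inner: "\<And>U e. open U \<Longrightarrow> 0 < e \<Longrightarrow> \<exists>C. closed C \<and> C \<subseteq> U \<and> measure M (U - C) < e"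
  shows "regular_borel_measure M"
  unfolding regular_borel_measure_def
proof (intro conjI fin sets_M ballI)
  interpret finite_measure M by (rule fin)
  note sets_M [simp]
  fix A :: "'a set" assume A: "A \<in> sets borel"
  have ex: "\<exists>C U. compact C \<and> open U \<and> C \<subseteq> A \<and> A \<subseteq> U
      \<and> emeasure M U \<le> emeasure M A + ennreal e \<and> emeasure M A \<le> emeasure M C + ennreal e" if "0 < e" for e
  proof -
    obtain C U where CU: "closed C" "open U" "C \<subseteq> A" "A \<subseteq> U" "measure M (U - C) < e"
      using closed_open_approx[OF fin sets_M inner A \<open>0 < e\<close>] by blast
    have m: "C \<in> sets borel" "U \<in> sets borel"
      using CU by auto
    then have "measure M (U - C) = measure M U - measure M C"
      using CU by (intro finite_measure_Diff) auto
    moreover have "measure M C \<le> measure M A" "measure M A \<le> measure M U"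
      using CU A m by (auto intro!: finite_measure_mono)
    moreover have "compact C"
      using compact_Int_closed[OF K CU(1)] by simp
    ultimately show ?thesis using CU
      by (intro exI[of _ C] exI[of _ U])
        (auto simp: emeasure_eq_measure ennreal_plus[symmetric] \<open>0 < e\<close> less_imp_le simp del: ennreal_plus)
  qed
  show "emeasure M A = (INF U\<in>{U. open U \<and> A \<subseteq> U}. emeasure M U)"
  proof (rule antisym)
    show "emeasure M A \<le> (INF U\<in>{U. open U \<and> A \<subseteq> U}. emeasure M U)"
      by (intro INF_greatest emeasure_mono) auto
    show "(INF U\<in>{U. open U \<and> A \<subseteq> U}. emeasure M U) \<le> emeasure M A"
    proof (rule ennreal_le_epsilon)
      fix e :: real assume "0 < e"
      from ex[OF this] obtain U where U: "open U" "A \<subseteq> U" "emeasure M U \<le> emeasure M A + ennreal e" by blast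
      then show "(INF U\<in>{U. open U \<and> A \<subseteq> U}. emeasure M U) \<le> emeasure M A + ennreal e"
        by (intro INF_lower2[of U]) auto
    qed
  qed
  show "emeasure M A = (SUP C\<in>{C. compact C \<and> C \<subseteq> A}. emeasure M C)"
  proof (rule antisym)
    show "(SUP C\<in>{C. compact C \<and> C \<subseteq> A}. emeasure M C) \<le> emeasure M A"
      using A by (intro SUP_least emeasure_mono) auto
    show "emeasure M A \<le> (SUP C\<in>{C. compact C \<and> C \<subseteq> A}. emeasure M C)"
    proof (rule ennreal_le_epsilon)
      fix e :: real assume "0 < e"
      from ex[OF this] obtain C where C: "compact C" "C \<subseteq> A" "emeasure M A \<le> emeasure M C + ennreal e" by blast
      then show "emeasure M A \<le> (SUP C\<in>{C. compact C \<and> C \<subseteq> A}. emeasure M C) + ennreal e"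
        by (intro order_trans[OF C(3)] add_right_mono SUP_upper) auto
    qed
  qed
qed

text \<open>For each rational below some element of \<open>D\<close>, one element above it is
  chosen. This is the substitute for second countability when preimages of open sets are written as
  countable unions.\<close>

lemma countable_cofinal:
  fixes D :: "real set"
  obtains Y where "countable Y" "Y \<subseteq> D" "\<And>d. d \<in> D \<Longrightarrow> \<exists>y\<in>Y. d \<le> y"
proof -
  define pick where "pick r = (SOME d. d \<in> D \<and> r \<le> d)" for r :: real
  define R where "R = {r\<in>\<rat>. \<exists>d\<in>D. r \<le> d}"
  \<comment> \<open>A maximum of \<open>D\<close> has no rational between itself and a larger
    element, so it is added by hand.\<close>
  define Y where "Y = pick ` R \<union> {m\<in>D. \<forall>d\<in>D. d \<le> m}"
  have pick: "pick r \<in> D \<and> r \<le> pick r" if "r \<in> R" for r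
    using that unfolding pick_def R_def by (intro someI_ex[of "\<lambda>d. d \<in> D \<and> r \<le> d"]) blast
  have "countable R"
    unfolding R_def by (rule countable_subset[OF _ countable_rat]) auto
  moreover have "countable {m\<in>D. \<forall>d\<in>D. d \<le> m}"
  proof (cases "\<exists>m\<in>D. \<forall>d\<in>D. d \<le> m")
    case True
    then obtain m where "m \<in> D" "\<forall>d\<in>D. d \<le> m" by blast
    then have "{m\<in>D. \<forall>d\<in>D. d \<le> m} = {m}" by (auto intro: antisym)
    then show ?thesis by simp
  next
    case False
    then have "{m\<in>D. \<forall>d\<in>D. d \<le> m} = {}" by blast
    then show ?thesis by (metis countable_empty)
  qed
  ultimately have "countable Y" by (simp add: Y_def)
  moreover have "Y \<subseteq> D" using pick by (auto simp: Y_def)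
  moreover have "\<exists>y\<in>Y. d \<le> y" if d: "d \<in> D" for d
  proof (cases "\<forall>d'\<in>D. d' \<le> d")
    case True
    then show ?thesis using d by (auto simp: Y_def)
  next
    case False
    then obtain d' where d': "d' \<in> D" "d < d'" by (auto simp: not_le)
    obtain r where "r \<in> \<rat>" "d < r" "r < d'"
      using Rats_dense_in_real[OF d'(2)] by blast
    then have "r \<in> R" using d' by (auto simp: R_def intro!: bexI[of _ d'])
    then show ?thesis using pick[of r] \<open>d < r\<close>
      by (intro bexI[of _ "pick r"]) (auto simp: Y_def)
  qed
  ultimately show ?thesis using that by blast
qed

text \<open>The order is not a well-order: \<open>LEAST\<close> denotes a minimum here only because
  compactness supplies one.\<close>

lemma kmin_le:
  fixes t :: "'a::linorder_topology"
  assumes "compact (UNIV :: 'a::linorder_topology set)"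
  shows "kmin \<le> t"
proof -
  obtain m :: 'a where "\<forall>t. m \<le> t"
    using compact_attains_inf[OF assms] by auto
  then have "kmin = m"
    unfolding kmin_def by (intro Least_equality) auto
  with \<open>\<forall>t. m \<le> t\<close> show ?thesis by simp
qed

lemma compact_line_max:
  assumes "compact (UNIV :: 'a::linorder_topology set)"
  obtains m :: "'a::linorder_topology" where "\<And>t. t \<le> m"
  using compact_attains_sup[OF assms] by auto

lemma kmin_atLeastAtMost:
  fixes t :: "'a::linorder_topology"
  assumes "compact (UNIV :: 'a::linorder_topology set)"
  shows "{kmin..t} = {..t}"
  using kmin_le[OF assms] by auto

text \<open>Right continuity and monotonicity make the level set \<open>{t. x \<le> G t}\<close>
  closed, hence compact; \<open>c\<close> witnesses that it is nonempty, so the minimum is attained.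
  The result is the Galois connection between \<open>G\<close> and its generalized inverse.\<close>

lemma right_continuous_mono_level:
  fixes G :: "'a::linorder_topology \<Rightarrow> real"
  assumes K: "compact (UNIV :: 'a set)" and "mono G" and "right_continuous G" and x: "x \<le> G c"
  shows "x \<le> G t \<longleftrightarrow> (LEAST t. x \<le> G t) \<le> t"
proof -
  let ?S = "{t. x \<le> G t}"
  have "open (- ?S)"
  proof (subst open_subopen, intro ballI)
    fix t assume "t \<in> - ?S"
    then have t: "\<not> x \<le> G t" by simp
    then have "(\<forall>\<^sub>F s in at_right t. G s < x)"
      using order_tendstoD(2)[of G "G t" "at_right t" x] assms(3) by (auto simp: right_continuous_def)
    show "\<exists>T. open T \<and> t \<in> T \<and> T \<subseteq> - ?S"
    proof (cases "\<exists>u. t < u")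
      \<comment> \<open>At the largest point the right filter is trivial and says nothing;
        monotonicity alone shows that the level set is empty.\<close>
      case False
      then have "G s \<le> G t" for s using \<open>mono G\<close> by (auto simp: not_less mono_def)
      then have "?S = {}" using t by (auto simp: not_le intro: le_less_trans)
      then show ?thesis by (intro exI[of _ UNIV]) auto
    next
      case True
      then obtain b where b: "b > t" "\<forall>y. t < y \<longrightarrow> y < b \<longrightarrow> G y < x"
        using \<open>\<forall>\<^sub>F s in at_right t. G s < x\<close> by (auto simp: eventually_at_right)
      have "G s < x" if "s < b" for s
      proof (cases "t < s")
        case False
        then have "G s \<le> G t" using \<open>mono G\<close> by (simp add: mono_def)
        then show ?thesis using t by simp
      qed (use b that in simp)
      then show ?thesis using b(1)
        by (intro exI[of _ "{..<b}"]) (fastforce simp: not_le)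
    qed
  qed
  then have "compact ?S"
    using compact_Int_closed[OF K, of ?S] by (simp add: closed_def)
  then obtain m where m: "x \<le> G m" "\<And>t. x \<le> G t \<Longrightarrow> m \<le> t"
    using compact_attains_inf[of ?S] x by auto
  then have "(LEAST t. x \<le> G t) = m" by (intro Least_equality)
  then show ?thesis
    using m order_trans[OF m(1) monoD[OF \<open>mono G\<close>, of m t]] by blast
qed

text \<open>The measure is the image of Lebesgue measure under the left-continuous generalized inverse of
  \<open>G\<close>. The line need not be second countable, but left continuity makes the preimage of every
  open set a countable union of half-open intervals; this gives both measurability and regularity.\<close>

lemma mono_right_continuous_measure:
  fixes G :: "'a::linorder_topology \<Rightarrow> real"
  assumes K: "compact (UNIV :: 'a set)" and "mono G" and "right_continuous G" and G0: "0 \<le> G kmin"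
  obtains M where "regular_borel_measure M" "\<And>t. measure M {kmin..t} = G t"
proof -
  obtain mx :: 'a where mx: "\<And>t. t \<le> mx" using compact_line_max[OF K] by blast
  define c where "c = G mx"
  define h where "h x = (LEAST t. x \<le> G t)" for x
  have h: "h x \<le> t \<longleftrightarrow> x \<le> G t" if "x \<le> c" for x t
    unfolding h_def using right_continuous_mono_level[OF K assms(2,3) that[unfolded c_def], of t] by blast
  have G_nonneg: "0 \<le> G t" for t
    by (rule order_trans[OF G0 monoD[OF \<open>mono G\<close> kmin_le[OF K]]])
  have G_le: "G t \<le> c" for t
    unfolding c_def by (rule monoD[OF \<open>mono G\<close> mx])
  have h_mono: "h x \<le> h y" if "x \<le> y" "y \<le> c" for x y
    using that h[of x "h y"] h[of y "h y"] by auto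
  \<comment> \<open>The countable union gives measurability of \<open>h\<close>. The inclusion of
    the closed intervals \<open>{h q..h y}\<close> in \<open>U\<close> is recorded for inner
    regularity.\<close>
  have preimage: "\<exists>Z. countable Z \<and> {0<..c} \<inter> h -` U = (\<Union>(q,y)\<in>Z. {q<..y}) \<and>
      (\<forall>(q,y)\<in>Z. 0 < q \<and> y \<le> c \<and> {h q..h y} \<subseteq> U)" if "open U" for U
  proof -
    define D where "D q = {y. q < y \<and> y \<le> c \<and> {h q..h y} \<subseteq> U}" for q
    have "\<forall>q. \<exists>Y. countable Y \<and> Y \<subseteq> D q \<and> (\<forall>d\<in>D q. \<exists>y\<in>Y. d \<le> y)"
      by (metis countable_cofinal)
    then obtain Y where Y: "\<And>q. countable (Y q)" "\<And>q. Y q \<subseteq> D q" "\<And>q d. d \<in> D q \<Longrightarrow> \<exists>y\<in>Y q. d \<le> y"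
      by metis
    define Z where "Z = Sigma (\<rat> \<inter> {0<..}) Y"
    have "countable (\<rat> \<inter> {0::real<..})"
      by (rule countable_subset[OF _ countable_rat]) auto
    then have "countable Z" unfolding Z_def using Y(1) by (intro countable_SIGMA) auto
    moreover have Z_sub: "0 < q \<and> q < y \<and> y \<le> c \<and> {h q..h y} \<subseteq> U" if "(q, y) \<in> Z" for q y
      using that Y(2)[of q] by (auto simp: Z_def D_def)
    moreover have "{0<..c} \<inter> h -` U = (\<Union>(q,y)\<in>Z. {q<..y})"
    proof (intro equalityI subsetI)
      fix x assume "x \<in> {0<..c} \<inter> h -` U"
      then have x: "0 < x" "x \<le> c" "h x \<in> U" by auto
      \<comment> \<open>This is left continuity of \<open>h\<close> at \<open>x\<close>: if
        \<open>{b<..h x}\<close> lies in \<open>U\<close>, then \<open>q0 = G b\<close> works, since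
        \<open>G b < q\<close> forces \<open>b < h q\<close>.\<close>
      have "\<exists>q0<x. 0 \<le> q0 \<and> (\<forall>q. q0 < q \<longrightarrow> q < x \<longrightarrow> {h q..h x} \<subseteq> U)"
      proof (cases "\<exists>u. u < h x")
        case False
        then have "{h q..h x} \<subseteq> {h x}" for q by (auto simp: not_less intro: antisym)
        then have "{h q..h x} \<subseteq> U" for q using x(3) by blast
        then show ?thesis using x(1) by blast
      next
        case True
        then obtain b where b: "b < h x" "{b<..h x} \<subseteq> U"
          using open_left[OF \<open>open U\<close> x(3)] by blast
        have "G b < x" using h[of x b] b x by auto
        moreover have "{h q..h x} \<subseteq> U" if "G b < q" "q < x" for q
        proof -
          have "b < h q" using h[of q b] that x by auto
          then have "{h q..h x} \<subseteq> {b<..h x}" by auto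
          then show ?thesis using b(2) by blast
        qed
        ultimately show ?thesis using G_nonneg[of b] by blast
      qed
      then obtain q0 where q0: "q0 < x" "0 \<le> q0" "\<And>q. q0 < q \<Longrightarrow> q < x \<Longrightarrow> {h q..h x} \<subseteq> U" by blast
      obtain q where q: "q \<in> \<rat>" "q0 < q" "q < x"
        using Rats_dense_in_real[OF q0(1)] by blast
      then have "x \<in> D q" using q0 x by (auto simp: D_def)
      then obtain y where "y \<in> Y q" "x \<le> y" using Y(3) by blast
      then show "x \<in> (\<Union>(q,y)\<in>Z. {q<..y})"
        using q q0 by (auto simp: Z_def intro!: bexI[of _ "(q, y)"])
    next
      fix x assume "x \<in> (\<Union>(q,y)\<in>Z. {q<..y})"
      then obtain q y where qy: "(q, y) \<in> Z" "q < x" "x \<le> y" by auto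
      then have "h x \<in> {h q..h y}" using Z_sub[OF qy(1)] by (auto intro: h_mono)
      then show "x \<in> {0<..c} \<inter> h -` U" using Z_sub[OF qy(1)] qy by auto
    qed
    ultimately show ?thesis by (intro exI[of _ Z]) auto
  qed
  \<comment> \<open>The interval starts at 0 and not at \<open>G kmin\<close>: the part up to
    \<open>G kmin\<close> is sent to \<open>kmin\<close> and becomes an atom of mass
    \<open>G kmin\<close>.\<close>
  let ?L = "restrict_space lborel {0<..c}"
  have h_meas: "h \<in> measurable ?L borel"
  proof (rule borel_measurableI)
    fix U :: "'a set" assume "open U"
    then obtain Z where "countable Z" "{0<..c} \<inter> h -` U = (\<Union>(q,y)\<in>Z. {q<..y})"
      using preimage by meson
    then have "h -` U \<inter> {0<..c} \<in> sets lborel"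
      by (auto simp: Int_commute intro!: sets.countable_UN'')
    then show "h -` U \<inter> space ?L \<in> sets ?L"
      by (auto simp: space_restrict_space sets_restrict_space)
  qed
  define M where "M = distr ?L borel h"
  have sets_M [simp]: "sets M = sets borel" by (simp add: M_def)
  have M_eq: "emeasure M A = emeasure lborel ({0<..c} \<inter> h -` A)" if "A \<in> sets borel" for A
  proof -
    have "h -` A \<inter> space ?L = {0<..c} \<inter> h -` A" by (auto simp: space_restrict_space)
    then show ?thesis
      unfolding M_def using that
      by (subst emeasure_distr[OF h_meas]) (auto simp: emeasure_restrict_space)
  qed
  have fin: "finite_measure M"
  proof
    have "emeasure M (space M) \<le> emeasure lborel {0<..c}"
      unfolding M_def by (subst M_eq[unfolded M_def]) (auto intro!: emeasure_mono)
    then show "emeasure M (space M) \<noteq> \<infinity>"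
      using G_nonneg[of mx] by (auto simp: c_def top_unique)
  qed
  interpret finite_measure M by (rule fin)
  have "regular_borel_measure M"
  proof (rule regular_borel_measureI[OF K fin sets_M])
    fix U :: "'a set" and e :: real assume U: "open U" "0 < e"
    from preimage[OF U(1)] obtain Z
      where "countable Z \<and> {0<..c} \<inter> h -` U = (\<Union>(q,y)\<in>Z. {q<..y})
        \<and> (\<forall>(q,y)\<in>Z. 0 < q \<and> y \<le> c \<and> {h q..h y} \<subseteq> U)" ..
    then have Z: "countable Z" "{0<..c} \<inter> h -` U = (\<Union>(q,y)\<in>Z. {q<..y})"
      and Z': "\<forall>(q,y)\<in>Z. 0 < q \<and> y \<le> c \<and> {h q..h y} \<subseteq> U"
      by simp_all
    show "\<exists>C. closed C \<and> C \<subseteq> U \<and> measure M (U - C) < e"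
    proof (cases "Z = {}")
      case True
      then have "measure M U = 0" using M_eq[of U] Z(2) U by (simp add: measure_def)
      then show ?thesis using U by (intro exI[of _ "{}"]) auto
    next
      case False
      define z where "z = from_nat_into Z"
      have z: "range z = Z" unfolding z_def using range_from_nat_into[OF False Z(1)] .
      \<comment> \<open>The closed intervals stay inside \<open>U\<close> and cover the image under
        \<open>h\<close> of the half-open ones. Points of \<open>U\<close> that they miss are not
        values of \<open>h\<close> on \<open>{0<..c}\<close>, so no mass is lost.\<close>
      define E where "E n = {h (fst (z n))..h (snd (z n))}" for n
      define D where "D n = (\<Union>k\<le>n. E k)" for n
      have E: "E n \<subseteq> U" "{fst (z n)<..snd (z n)} \<subseteq> h -` E n" for n
      proof -
        have "(fst (z n), snd (z n)) \<in> Z" using z by auto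
        with Z' have "0 < fst (z n) \<and> snd (z n) \<le> c \<and> {h (fst (z n))..h (snd (z n))} \<subseteq> U"
          by blast
        then show "E n \<subseteq> U" "{fst (z n)<..snd (z n)} \<subseteq> h -` E n"
          by (auto simp: E_def intro!: h_mono)
      qed
      have D_meas: "D n \<in> sets borel" and D_closed: "closed (D n)" and D_sub: "D n \<subseteq> U" for n
        unfolding D_def using E(1) by (auto simp: E_def intro!: closed_UN sets.finite_UN)
      have "{0<..c} \<inter> h -` U = {0<..c} \<inter> h -` (\<Union>n. D n)"
      proof (intro equalityI subsetI)
        fix x assume x: "x \<in> {0<..c} \<inter> h -` U"
        then obtain q y where qy: "(q,y) \<in> Z" "x \<in> {q<..y}" using Z(2) by auto
        then obtain n where "z n = (q,y)" using z by (metis imageE)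
        then have "h x \<in> E n" using E(2)[of n] qy by auto
        then show "x \<in> {0<..c} \<inter> h -` (\<Union>n. D n)" using x by (auto simp: D_def)
      next
        fix x assume "x \<in> {0<..c} \<inter> h -` (\<Union>n. D n)"
        then show "x \<in> {0<..c} \<inter> h -` U" using D_sub by auto
      qed
      then have "emeasure M U = emeasure M (\<Union>n. D n)"
        using U D_meas by (auto simp: M_eq)
      then have eq: "measure M U = measure M (\<Union>n. D n)" by (simp add: measure_def)
      have "incseq D"
        unfolding D_def by (intro monoI UN_mono) auto
      then have "(\<lambda>n. measure M (D n)) \<longlonglongrightarrow> measure M U"
        unfolding eq using D_meas by (intro finite_Lim_measure_incseq) auto
      then have "\<forall>\<^sub>F n in sequentially. \<bar>measure M (D n) - measure M U\<bar> < e"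
        using U by (auto simp: tendsto_iff dist_real_def)
      then obtain n where "\<bar>measure M (D n) - measure M U\<bar> < e"
        by (auto simp: eventually_sequentially)
      then have "measure M (U - D n) < e"
        using D_meas D_sub U by (subst finite_measure_Diff) auto
      then show ?thesis using D_closed D_sub by blast
    qed
  qed
  moreover have "measure M {kmin..t} = G t" for t
  proof -
    have "{0<..c} \<inter> h -` {kmin..t} = {0<..G t}"
      unfolding kmin_atLeastAtMost[OF K] using h[of _ t] G_le[of t] by auto
    then have "emeasure M {kmin..t} = ennreal (G t)"
      using G_nonneg[of t] by (subst M_eq) auto
    then show ?thesis using G_nonneg[of t] by (simp add: measure_def)
  qed
  ultimately show ?thesis using that by blast
qed

subsection \<open>Jordan decomposition\<close>

text \<open>Variation is counted from a point to the right end: right continuity then follows by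
  shortening the first step of a nearly optimal chain, without additivity of the variation.\<close>

definition tail_sums :: "('a::linorder \<Rightarrow> real) \<Rightarrow> 'a \<Rightarrow> real set" where
  "tail_sums F a = {(\<Sum>j<n. \<bar>F (t (Suc j)) - F (t j)\<bar>) | t n. t 0 = a \<and> (\<forall>j<n. t j < t (Suc j))}"

definition tail_variation :: "('a::linorder \<Rightarrow> real) \<Rightarrow> 'a \<Rightarrow> real" where
  "tail_variation F a = Sup (tail_sums F a)"

lemma tail_sums_bdd_above: "bounded_variation F \<Longrightarrow> bdd_above (tail_sums F a)"
  unfolding bounded_variation_def
  by (rule bdd_above_mono) (auto simp: tail_sums_def variation_sums_def)

lemma zero_in_tail_sums: "0 \<in> tail_sums F a"
  unfolding tail_sums_def by (auto intro!: exI[of _ "\<lambda>_. a"] exI[of _ "0::nat"])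

lemma chain_sum_le_variation:
  assumes "bounded_variation F" "\<And>j. j < n \<Longrightarrow> t j < t (Suc j)"
  shows "(\<Sum>j<n. \<bar>F (t (Suc j)) - F (t j)\<bar>) \<le> variation F"
  unfolding variation_def
  using assms by (intro cSup_upper) (auto simp: variation_sums_def bounded_variation_def)

lemma chain_sum_le_tail_variation:
  assumes "bounded_variation F" "\<And>j. j < n \<Longrightarrow> t j < t (Suc j)"
  shows "(\<Sum>j<n. \<bar>F (t (Suc j)) - F (t j)\<bar>) \<le> tail_variation F (t 0)"
  unfolding tail_variation_def
  using assms(2) by (intro cSup_upper tail_sums_bdd_above assms(1)) (auto simp: tail_sums_def)

lemma tail_variation_nonneg: "bounded_variation F \<Longrightarrow> 0 \<le> tail_variation F a"
  unfolding tail_variation_def by (intro cSup_upper zero_in_tail_sums tail_sums_bdd_above)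

lemma tail_variation_le_variation: "bounded_variation F \<Longrightarrow> tail_variation F a \<le> variation F"
  unfolding tail_variation_def
  using zero_in_tail_sums[of F a]
  by (intro cSup_least) (auto simp: tail_sums_def intro!: chain_sum_le_variation)

lemma chain_Cons_sum_le:
  assumes "bounded_variation F" "a < t 0" "\<And>j. j < n \<Longrightarrow> t j < t (Suc j)"
  shows "\<bar>F (t 0) - F a\<bar> + (\<Sum>j<n. \<bar>F (t (Suc j)) - F (t j)\<bar>) \<le> tail_variation F a"
proof -
  have "case_nat a t j < case_nat a t (Suc j)" if "j < Suc n" for j
    using assms(2,3) that by (cases j) auto
  from chain_sum_le_tail_variation[where t = "case_nat a t" and n = "Suc n", OF assms(1) this]
  show ?thesis by (simp add: sum.lessThan_Suc_shift del: sum.lessThan_Suc)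
qed

text \<open>Chains from \<open>b\<close> become chains from \<open>a\<close> by prepending one
  point. The resulting drop of the tail variation dominates every increment of \<open>F\<close>,
  which is what makes both parts of the Jordan decomposition monotone.\<close>

lemma tail_variation_less:
  assumes bv: "bounded_variation F" and "a < b"
  shows "\<bar>F b - F a\<bar> + tail_variation F b \<le> tail_variation F a"
proof -
  have "tail_variation F b \<le> tail_variation F a - \<bar>F b - F a\<bar>"
    unfolding tail_variation_def[of F b]
  proof (rule cSup_least)
    fix x assume "x \<in> tail_sums F b"
    then obtain t n where t: "t 0 = b" "\<And>j. j < n \<Longrightarrow> t j < t (Suc j)"
      and x: "x = (\<Sum>j<n. \<bar>F (t (Suc j)) - F (t j)\<bar>)"
      by (auto simp: tail_sums_def)
    show "x \<le> tail_variation F a - \<bar>F b - F a\<bar>"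
      using chain_Cons_sum_le[OF bv, of a t n] t \<open>a < b\<close> x by simp
  qed (use zero_in_tail_sums[of F b] in auto)
  then show ?thesis by simp
qed

lemma tail_variation_right_continuous:
  fixes F :: "'a::linorder_topology \<Rightarrow> real"
  assumes bv: "bounded_variation F" and rc: "right_continuous F"
  shows "right_continuous (tail_variation F)"
  unfolding right_continuous_def
proof (intro allI tendstoI)
  fix a and e :: real assume "0 < e"
  then have "tail_variation F a - e/2 < Sup (tail_sums F a)"
    by (simp add: tail_variation_def)
  then obtain x where "x \<in> tail_sums F a" and x: "tail_variation F a - e/2 < x"
    using less_cSup_iff[of "tail_sums F a"] zero_in_tail_sums[of F a] tail_sums_bdd_above[OF bv] by auto
  then obtain t n where t: "t 0 = a" "\<And>j. j < n \<Longrightarrow> t j < t (Suc j)"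
    and x_eq: "x = (\<Sum>j<n. \<bar>F (t (Suc j)) - F (t j)\<bar>)"
    by (auto simp: tail_sums_def)
  have gt: "\<forall>\<^sub>F s in at_right a. a < s"
    by (simp add: eventually_at_filter)
  have "\<forall>\<^sub>F s in at_right a. tail_variation F a - e < tail_variation F s"
  proof (cases n)
    \<comment> \<open>A one-point chain has sum 0, so near-optimality already makes the tail
      variation at \<open>a\<close> smaller than \<open>e\<close>.\<close>
    case 0
    then have "tail_variation F a < e" using x x_eq \<open>0 < e\<close> by simp
    then show ?thesis
      by (intro always_eventually allI less_le_trans[OF _ tail_variation_nonneg[OF bv]]) simp
  next
    \<comment> \<open>Moving the first node from \<open>a\<close> to \<open>s\<close> below
      \<open>t 1\<close> costs at most \<open>e/2\<close>; the other \<open>e/2\<close> is the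
      defect from optimality of the chain.\<close>
    case (Suc m)
    have "(F \<longlongrightarrow> F a) (at_right a)" using rc by (simp add: right_continuous_def)
    from tendstoD[OF this, of "e/2"] have "\<forall>\<^sub>F s in at_right a. \<bar>F s - F a\<bar> < e/2"
      using \<open>0 < e\<close> by (simp add: dist_real_def)
    moreover have "\<forall>\<^sub>F s in at_right a. s < t 1"
      using t(2)[of 0] t(1) Suc by (intro order_tendstoD(2)[OF tendsto_ident_at]) simp
    ultimately show ?thesis using gt
    proof eventually_elim
      case (elim s)
      have "x = \<bar>F (t 1) - F a\<bar> + (\<Sum>j<m. \<bar>F (t (Suc (Suc j))) - F (t (Suc j))\<bar>)"
        by (simp add: x_eq Suc sum.lessThan_Suc_shift t(1) del: sum.lessThan_Suc)
      moreover have "\<bar>F (t 1) - F s\<bar> + (\<Sum>j<m. \<bar>F (t (Suc (Suc j))) - F (t (Suc j))\<bar>) \<le> tail_variation F s"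
        using chain_Cons_sum_le[OF bv, of s "\<lambda>j. t (Suc j)" m] elim t(2) Suc by simp
      ultimately show ?case using elim x by linarith
    qed
  qed
  then show "\<forall>\<^sub>F s in at_right a. dist (tail_variation F s) (tail_variation F a) < e"
    using gt
  proof eventually_elim
    case (elim s)
    then show ?case using tail_variation_less[OF bv, of a s] by (simp add: dist_real_def)
  qed
qed

lemma abs_le_nbv_norm:
  fixes F :: "'a::linorder_topology \<Rightarrow> real"
  assumes K: "compact (UNIV :: 'a set)" and bv: "bounded_variation F"
  shows "\<bar>F t\<bar> \<le> nbv_norm F"
proof -
  have "\<bar>F t - F kmin\<bar> \<le> variation F"
  proof (cases "t = kmin")
    case True
    then show ?thesis
      using order_trans[OF tail_variation_nonneg[OF bv, of t] tail_variation_le_variation[OF bv]] by simp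
  next
    case False
    then have "kmin < t" using kmin_le[OF K, of t] by simp
    then show ?thesis
      using tail_variation_less[OF bv, of kmin t] tail_variation_nonneg[OF bv, of t]
        tail_variation_le_variation[OF bv, of kmin] by linarith
  qed
  then show ?thesis by (simp add: nbv_norm_def)
qed

text \<open>The factor 3 is crude: \<open>P\<close> has mass \<open>G mx\<close>, at most the norm,
  and \<open>N\<close> has mass \<open>G mx - F mx\<close>, at most twice the norm.\<close>

lemma NBV_represents:
  fixes F :: "'a::linorder_topology \<Rightarrow> real"
  assumes K: "compact (UNIV :: 'a set)" and F: "F \<in> NBV"
  obtains P N where "represents F P N" "measure P UNIV + measure N UNIV \<le> 3 * nbv_norm F"
proof -
  have bv: "bounded_variation F" and rc: "right_continuous F" using F by (auto simp: NBV_def)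
  obtain mx :: 'a where mx: "\<And>t. t \<le> mx" using compact_line_max[OF K] by blast
  have UNIV_eq: "UNIV = {kmin..mx}" using kmin_le[OF K] mx by auto
  \<comment> \<open>The difference of tail variations plays the role of the variation on
    \<open>{kmin..t}\<close>; the constant \<open>\<bar>F kmin\<bar>\<close> makes \<open>G\<close>
    and \<open>H\<close> nonnegative at \<open>kmin\<close>.\<close>
  define G where "G t = \<bar>F kmin\<bar> + tail_variation F kmin - tail_variation F t" for t
  define H where "H t = G t - F t" for t
  have step: "\<bar>F b - F a\<bar> \<le> G b - G a" if "a \<le> b" for a b
    using tail_variation_less[OF bv, of a b] that by (cases "a = b") (auto simp: G_def less_le)
  have "mono G" "mono H"
    using step by (force intro!: monoI simp: H_def)+
  have rcG: "right_continuous G"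
    using tail_variation_right_continuous[OF bv rc] unfolding right_continuous_def G_def
    by (auto intro!: tendsto_intros)
  then have rcH: "right_continuous H"
    using rc unfolding right_continuous_def H_def by (auto intro!: tendsto_intros)
  have G0: "0 \<le> G kmin" and H0: "0 \<le> H kmin" by (simp_all add: G_def H_def)
  obtain P where P: "regular_borel_measure P" "\<And>t. measure P {kmin..t} = G t"
    using mono_right_continuous_measure[OF K \<open>mono G\<close> rcG G0] by blast
  obtain N where N: "regular_borel_measure N" "\<And>t. measure N {kmin..t} = H t"
    using mono_right_continuous_measure[OF K \<open>mono H\<close> rcH H0] by blast
  have "represents F P N" using P N by (simp add: represents_def H_def)
  moreover have "G mx \<le> nbv_norm F"
    using tail_variation_nonneg[OF bv, of mx] tail_variation_le_variation[OF bv, of kmin]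
    by (simp add: G_def nbv_norm_def)
  then have "measure P UNIV + measure N UNIV \<le> 3 * nbv_norm F"
    using abs_le_nbv_norm[OF K bv, of mx] unfolding UNIV_eq P N H_def by linarith
  ultimately show ?thesis using that by blast
qed

subsection \<open>Step function approximation\<close>

text \<open>The second conjunct carries the induction: to the right of \<open>t n\<close> the
  partial sum vanishes, so the next cell contributes its value alone.\<close>

lemma step_function_approx:
  fixes g :: "'a::linorder \<Rightarrow> real"
  assumes least: "\<And>x. t 0 \<le> (x::'a)" and t: "\<And>j. j < n \<Longrightarrow> t j < t (Suc j)"
    and g: "\<And>j x. j < n \<Longrightarrow> t j < x \<Longrightarrow> x \<le> t (Suc j) \<Longrightarrow> \<bar>g x - g (t (Suc j))\<bar> \<le> e"
    and "0 \<le> e"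
  defines "\<phi> \<equiv> \<lambda>n x. g (t 0) * indicator {..t 0} x + (\<Sum>j<n. g (t (Suc j)) * indicator {t j<..t (Suc j)} x)"
  shows "(x \<le> t n \<longrightarrow> \<bar>g x - \<phi> n x\<bar> \<le> e) \<and> (t n < x \<longrightarrow> \<phi> n x = 0)"
  using t g
proof (induction n)
  case 0
  then show ?case using least[of x] \<open>0 \<le> e\<close> by (auto simp: \<phi>_def indicator_def)
next
  case (Suc n)
  have IH: "(x \<le> t n \<longrightarrow> \<bar>g x - \<phi> n x\<bar> \<le> e) \<and> (t n < x \<longrightarrow> \<phi> n x = 0)"
    by (rule Suc.IH) (use Suc.prems in auto)
  have "\<phi> (Suc n) x = \<phi> n x + g (t (Suc n)) * indicator {t n<..t (Suc n)} x"
    by (simp only: \<phi>_def sum.lessThan_Suc add.assoc)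
  moreover have "t n < t (Suc n)" using Suc.prems(1) by simp
  ultimately show ?case
    using IH Suc.prems(2)[of n x] by (auto simp: indicator_def not_less)
qed

lemma represents_finite_measure:
  assumes "represents F P N"
  shows "finite_measure P" "finite_measure N" "sets P = sets borel" "sets N = sets borel"
  using assms by (auto simp: represents_def regular_borel_measure_def)

lemma bounded_borel_integrable:
  fixes g :: "'a::topological_space \<Rightarrow> real"
  assumes "finite_measure M" "sets M = sets borel" "g \<in> borel_measurable borel" "\<And>x. \<bar>g x\<bar> \<le> B"
  shows "integrable M g"
proof -
  have "g \<in> borel_measurable M" using assms(2,3) measurable_cong_sets by blast
  then show ?thesis using assms(1,4)
    by (intro finite_measure.integrable_const_bound[where B=B]) auto
qed

text \<open>The cells \<open>{kmin}\<close> and \<open>{t j<..t (Suc j)}\<close> partition the line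
  and their measures are differences of the distribution function. The sum is thus the integral of
  the step function that samples \<open>g\<close> at right endpoints.\<close>

lemma integral_step_approx:
  fixes g :: "'a::linorder_topology \<Rightarrow> real"
  assumes M: "finite_measure M" "sets M = sets borel"
    and g: "g \<in> borel_measurable borel" "\<And>x. \<bar>g x\<bar> \<le> B"
    and t: "t 0 = kmin" "\<And>j. j < n \<Longrightarrow> t j < t (Suc j)" "\<And>x. kmin \<le> (x::'a)" "\<And>x. x \<le> t n"
    and osc: "\<And>j x. j < n \<Longrightarrow> t j < x \<Longrightarrow> x \<le> t (Suc j) \<Longrightarrow> \<bar>g x - g (t (Suc j))\<bar> \<le> e"
    and "0 \<le> e"
  shows "\<bar>integral\<^sup>L M g - (g kmin * measure M {kmin..kmin} +
      (\<Sum>j<n. g (t (Suc j)) * (measure M {kmin..t (Suc j)} - measure M {kmin..t j})))\<bar> \<le> e * measure M UNIV"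
proof -
  interpret finite_measure M by (rule M)
  have sp [simp]: "space M = UNIV" using sets_eq_imp_space_eq[OF M(2)] by simp
  note M(2) [simp]
  define \<phi> where "\<phi> x = g (t 0) * indicator {..t 0} x + (\<Sum>j<n. g (t (Suc j)) * indicator {t j<..t (Suc j)} x)" for x
  have close: "\<bar>g x - \<phi> x\<bar> \<le> e" for x
  proof -
    have "(x \<le> t n \<longrightarrow> \<bar>g x - \<phi> x\<bar> \<le> e) \<and> (t n < x \<longrightarrow> \<phi> x = 0)"
      unfolding \<phi>_def by (rule step_function_approx) (use t osc \<open>0 \<le> e\<close> in auto)
    then show ?thesis using t(4) by blast
  qed
  have int_g: "integrable M g" by (rule bounded_borel_integrable[OF M g])
  have int_ind: "integrable M (\<lambda>x. c * indicator A x :: real)" if "A \<in> sets borel" for A c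
    using that by (intro integrable_mult_right integrable_real_indicator) (auto simp: emeasure_eq_measure)
  have int_\<phi>: "integrable M \<phi>"
    unfolding \<phi>_def by (intro Bochner_Integration.integrable_add Bochner_Integration.integrable_sum int_ind) auto
  have diff: "measure M {a<..b} = measure M {kmin..b} - measure M {kmin..a}" if "a \<le> b" for a b
  proof -
    have "{a<..b} = {kmin..b} - {kmin..a}" using t(3) by auto
    then show ?thesis using that by (simp add: finite_measure_Diff)
  qed
  have "integral\<^sup>L M \<phi> = (\<integral>x. g (t 0) * indicator {..t 0} x \<partial>M)
      + (\<integral>x. (\<Sum>j<n. g (t (Suc j)) * indicator {t j<..t (Suc j)} x) \<partial>M)"
    unfolding \<phi>_def by (intro Bochner_Integration.integral_add Bochner_Integration.integrable_sum int_ind) auto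
  also have "(\<integral>x. (\<Sum>j<n. g (t (Suc j)) * indicator {t j<..t (Suc j)} x) \<partial>M) =
      (\<Sum>j<n. \<integral>x. g (t (Suc j)) * indicator {t j<..t (Suc j)} x \<partial>M)"
    by (intro Bochner_Integration.integral_sum int_ind) auto
  also have "\<dots> = (\<Sum>j<n. g (t (Suc j)) * (measure M {kmin..t (Suc j)} - measure M {kmin..t j}))"
    using t(2) by (intro sum.cong) (auto simp: diff less_imp_le)
  also have "(\<integral>x. g (t 0) * indicator {..t 0} x \<partial>M) = g kmin * measure M {kmin..kmin}"
  proof -
    have "{..kmin} = {kmin..kmin::'a}" using t(3) by (auto intro: antisym)
    then show ?thesis by (simp add: t(1))
  qed
  finally have "integral\<^sup>L M \<phi> = g kmin * measure M {kmin..kmin} +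
      (\<Sum>j<n. g (t (Suc j)) * (measure M {kmin..t (Suc j)} - measure M {kmin..t j}))" .
  moreover have "\<bar>integral\<^sup>L M g - integral\<^sup>L M \<phi>\<bar> \<le> e * measure M UNIV"
  proof -
    have "\<bar>integral\<^sup>L M g - integral\<^sup>L M \<phi>\<bar> = \<bar>\<integral>x. g x - \<phi> x \<partial>M\<bar>"
      by (simp add: int_g int_\<phi>)
    also have "\<dots> \<le> (\<integral>x. \<bar>g x - \<phi> x\<bar> \<partial>M)" by (rule integral_abs_bound)
    also have "\<dots> \<le> (\<integral>x. e \<partial>M)"
      using close by (intro integral_mono integrable_abs Bochner_Integration.integrable_diff int_g int_\<phi>) auto
    also have "\<dots> = e * measure M UNIV" by simp
    finally show ?thesis .
  qed
  ultimately show ?thesis by simp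
qed

text \<open>The approximating sum is linear in the distribution function, so the estimates for
  \<open>P\<close> and \<open>N\<close> can be subtracted; only their errors add.\<close>

lemma represents_step_approx:
  fixes g :: "'a::linorder_topology \<Rightarrow> real"
  assumes rep: "represents F P N"
    and g: "g \<in> borel_measurable borel" "\<And>x. \<bar>g x\<bar> \<le> B"
    and t: "t 0 = kmin" "\<And>j. j < n \<Longrightarrow> t j < t (Suc j)" "\<And>x. kmin \<le> (x::'a)" "\<And>x. x \<le> t n"
    and osc: "\<And>j x. j < n \<Longrightarrow> t j < x \<Longrightarrow> x \<le> t (Suc j) \<Longrightarrow> \<bar>g x - g (t (Suc j))\<bar> \<le> e"
    and "0 \<le> e"
  shows "\<bar>(integral\<^sup>L P g - integral\<^sup>L N g) - (g kmin * F kmin +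
      (\<Sum>j<n. g (t (Suc j)) * (F (t (Suc j)) - F (t j))))\<bar> \<le> e * (measure P UNIV + measure N UNIV)"
proof -
  let ?S = "\<lambda>m. g kmin * m kmin + (\<Sum>j<n. g (t (Suc j)) * (m (t (Suc j)) - m (t j)))"
  have F_eq: "F = (\<lambda>t. measure P {kmin..t} - measure N {kmin..t})"
    using rep by (auto simp: represents_def)
  have "?S F = ?S (\<lambda>t. measure P {kmin..t}) - ?S (\<lambda>t. measure N {kmin..t})"
    unfolding F_eq by (simp add: algebra_simps sum_subtractf sum.distrib)
  moreover have "\<bar>integral\<^sup>L P g - ?S (\<lambda>t. measure P {kmin..t})\<bar> \<le> e * measure P UNIV"
    using represents_finite_measure[OF rep] assms by (intro integral_step_approx) auto
  moreover have "\<bar>integral\<^sup>L N g - ?S (\<lambda>t. measure N {kmin..t})\<bar> \<le> e * measure N UNIV"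
    using represents_finite_measure[OF rep] assms by (intro integral_step_approx) auto
  ultimately show ?thesis unfolding distrib_left by linarith
qed

text \<open>The half-open \<open>{x..<y}\<close> lets \<open>g\<close> jump immediately to the right
  of a cut point. Thus indicators of \<open>{..s}\<close> qualify along with continuous functions,
  and so do the mixtures of both to which \<open>represents_bound\<close> is applied.\<close>

definition step_approximable :: "('a::linorder \<Rightarrow> real) \<Rightarrow> bool" where
  "step_approximable g \<longleftrightarrow>
    (\<forall>e>0. \<exists>T. finite T \<and> (\<forall>x y. x \<le> y \<longrightarrow> T \<inter> {x..<y} = {} \<longrightarrow> \<bar>g x - g y\<bar> \<le> e))"

lemma step_approximableE:
  assumes "step_approximable g" "0 < e"
  obtains T where "finite T" "\<And>x y. x \<le> y \<Longrightarrow> T \<inter> {x..<y} = {} \<Longrightarrow> \<bar>g x - g y\<bar> \<le> e"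
  using assms unfolding step_approximable_def by meson

lemma step_approximable_indicator: "step_approximable (indicator {..s})"
  unfolding step_approximable_def
proof (intro allI impI)
  fix e :: real assume "0 < e"
  have "\<bar>indicator {..s} x - indicator {..s} y\<bar> \<le> e" if "x \<le> y" "{s} \<inter> {x..<y} = {}" for x y
    using that \<open>0 < e\<close> by (auto simp: indicator_def)
  then show "\<exists>T. finite T \<and> (\<forall>x y. x \<le> y \<longrightarrow> T \<inter> {x..<y} = {} \<longrightarrow> \<bar>indicator {..s} x - indicator {..s} y\<bar> \<le> e)"
    by (intro exI[of _ "{s}"]) auto
qed

lemma step_approximable_cmult:
  assumes "step_approximable g"
  shows "step_approximable (\<lambda>x. c * g x)"
  unfolding step_approximable_def
proof (intro allI impI)
  fix e :: real assume "0 < e"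
  then have "0 < e / (\<bar>c\<bar> + 1)" by (auto intro!: divide_pos_pos)
  obtain T where T: "finite T" "\<And>x y. x \<le> y \<Longrightarrow> T \<inter> {x..<y} = {} \<Longrightarrow> \<bar>g x - g y\<bar> \<le> e / (\<bar>c\<bar> + 1)"
    using step_approximableE[OF assms \<open>0 < e / (\<bar>c\<bar> + 1)\<close>] by blast
  have "\<bar>c * g x - c * g y\<bar> \<le> e" if "x \<le> y" "T \<inter> {x..<y} = {}" for x y
  proof -
    have "\<bar>c * g x - c * g y\<bar> = \<bar>c\<bar> * \<bar>g x - g y\<bar>"
      by (simp add: abs_mult[symmetric] right_diff_distrib)
    also have "\<dots> \<le> (\<bar>c\<bar> + 1) * (e / (\<bar>c\<bar> + 1))"
      using T(2)[OF that] by (intro mult_mono) auto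
    also have "\<dots> = e" by simp
    finally show ?thesis .
  qed
  with T(1) show "\<exists>T. finite T \<and> (\<forall>x y. x \<le> y \<longrightarrow> T \<inter> {x..<y} = {} \<longrightarrow> \<bar>c * g x - c * g y\<bar> \<le> e)"
    by blast
qed

lemma step_approximable_add:
  assumes "step_approximable f" "step_approximable g"
  shows "step_approximable (\<lambda>x. f x + g x)"
  unfolding step_approximable_def
proof (intro allI impI)
  fix e :: real assume "0 < e"
  then have "0 < e / 2" by simp
  obtain S where S: "finite S" "\<And>x y. x \<le> y \<Longrightarrow> S \<inter> {x..<y} = {} \<Longrightarrow> \<bar>f x - f y\<bar> \<le> e / 2"
    using step_approximableE[OF assms(1) \<open>0 < e / 2\<close>] by blast
  obtain T where T: "finite T" "\<And>x y. x \<le> y \<Longrightarrow> T \<inter> {x..<y} = {} \<Longrightarrow> \<bar>g x - g y\<bar> \<le> e / 2"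
    using step_approximableE[OF assms(2) \<open>0 < e / 2\<close>] by blast
  have "\<bar>(f x + g x) - (f y + g y)\<bar> \<le> e" if "x \<le> y" "(S \<union> T) \<inter> {x..<y} = {}" for x y
  proof -
    have "S \<inter> {x..<y} = {}" "T \<inter> {x..<y} = {}" using that(2) by blast+
    then show ?thesis using S(2)[OF that(1)] T(2)[OF that(1)] by linarith
  qed
  then show "\<exists>T. finite T \<and> (\<forall>x y. x \<le> y \<longrightarrow> T \<inter> {x..<y} = {} \<longrightarrow> \<bar>(f x + g x) - (f y + g y)\<bar> \<le> e)"
    using S(1) T(1) by (intro exI[of _ "S \<union> T"]) simp
qed

lemma step_approximable_sum:
  assumes "finite S" "\<And>s. s \<in> S \<Longrightarrow> step_approximable (g s)"
  shows "step_approximable (\<lambda>x. \<Sum>s\<in>S. g s x)"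
  using assms
proof (induction S rule: finite_induct)
  case empty
  then show ?case by (auto simp: step_approximable_def)
next
  case (insert s S)
  then show ?case by (simp add: step_approximable_add)
qed

text \<open>By compactness a local form suffices, in which only the right end \<open>y\<close> is
  assumed near \<open>p\<close>: the absence of cut points between \<open>x\<close> and
  \<open>y\<close> pulls \<open>x\<close> into the same neighbourhood.\<close>

lemma continuous_step_approximable:
  fixes f :: "'a::linorder_topology \<Rightarrow> real"
  assumes K: "compact (UNIV :: 'a set)" and f: "continuous_on UNIV f"
  shows "step_approximable f"
  unfolding step_approximable_def
proof (intro allI impI)
  fix e :: real assume "0 < e"
  have "\<exists>U A. open U \<and> p \<in> U \<and> finite A \<and>
      (\<forall>x y. y \<in> U \<longrightarrow> x \<le> y \<longrightarrow> A \<inter> {x..<y} = {} \<longrightarrow> \<bar>f x - f y\<bar> \<le> e)" for p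
  proof -
    define W where "W = {z. \<bar>f z - f p\<bar> < e/2}"
    have "open W" unfolding W_def
      by (intro open_Collect_less continuous_intros f)
    have "p \<in> W" using \<open>0 < e\<close> by (simp add: W_def)
    have W: "\<bar>f x - f y\<bar> \<le> e" if "x \<in> W" "y \<in> W" for x y
      using that unfolding W_def mem_Collect_eq by linarith
    \<comment> \<open>\<open>R\<close> is an initial segment, so it contains \<open>x\<close> along
      with \<open>y\<close>. \<open>L\<close> is a final segment starting after some
      \<open>a\<close>; making \<open>a\<close> a cut point prevents \<open>x\<close> from lying on
      the other side.\<close>
    obtain R where R: "open R" "p \<in> R" "R \<inter> {p..} \<subseteq> W" "\<And>x y. x \<le> y \<Longrightarrow> y \<in> R \<Longrightarrow> x \<in> R"
    proof (cases "\<exists>u. p < u")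
      case True
      then obtain b where "b > p" "{p..<b} \<subseteq> W"
        using open_right[OF \<open>open W\<close> \<open>p \<in> W\<close>] by blast
      then show ?thesis by (intro that[of "{..<b}"]) auto
    next
      case False
      then have "{p..} \<subseteq> {p}" by (auto simp: not_less intro: antisym)
      then show ?thesis using \<open>p \<in> W\<close> by (intro that[of UNIV]) auto
    qed
    obtain L A where L: "open L" "p \<in> L" "L \<inter> {..p} \<subseteq> W" "finite A"
      "\<And>x y. x \<le> y \<Longrightarrow> y \<in> L \<Longrightarrow> A \<inter> {x..<y} = {} \<Longrightarrow> x \<in> L"
    proof (cases "\<exists>u. u < p")
      case True
      then obtain a where "a < p" "{a<..p} \<subseteq> W"
        using open_left[OF \<open>open W\<close> \<open>p \<in> W\<close>] by blast
      then show ?thesis by (intro that[of "{a<..}" "{a}"]) auto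
    next
      case False
      then have "{..p} \<subseteq> {p}" by (auto simp: not_less intro: antisym)
      then show ?thesis using \<open>p \<in> W\<close> by (intro that[of UNIV "{}"]) auto
    qed
    have "L \<inter> R \<subseteq> W"
    proof
      fix x assume "x \<in> L \<inter> R"
      then show "x \<in> W" using L(3) R(3) by (cases "x \<le> p") auto
    qed
    moreover have "x \<in> L \<inter> R" if "y \<in> L \<inter> R" "x \<le> y" "A \<inter> {x..<y} = {}" for x y
      using that L(5) R(4) by blast
    ultimately have "\<bar>f x - f y\<bar> \<le> e" if "y \<in> L \<inter> R" "x \<le> y" "A \<inter> {x..<y} = {}" for x y
      using that by (meson W subsetD)
    then show ?thesis using R L
      by (intro exI[of _ "L \<inter> R"] exI[of _ A]) auto
  qed
  then obtain U A where UA: "\<And>p. open (U p)" "\<And>p. p \<in> U p" "\<And>p. finite (A p)"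
    "\<And>p x y. y \<in> U p \<Longrightarrow> x \<le> y \<Longrightarrow> A p \<inter> {x..<y} = {} \<Longrightarrow> \<bar>f x - f y\<bar> \<le> e"
    by metis
  obtain C where C: "finite C" "UNIV \<subseteq> (\<Union>p\<in>C. U p)"
    using UA(1,2) by (metis UNIV_I UN_I compactE_image[OF K, of UNIV U] subsetI)
  have "\<bar>f x - f y\<bar> \<le> e" if "x \<le> y" "(\<Union>p\<in>C. A p) \<inter> {x..<y} = {}" for x y
  proof -
    obtain p where "p \<in> C" "y \<in> U p" using C(2) by blast
    then show ?thesis using UA(4)[of y p x] that by blast
  qed
  then show "\<exists>T. finite T \<and> (\<forall>x y. x \<le> y \<longrightarrow> T \<inter> {x..<y} = {} \<longrightarrow> \<bar>f x - f y\<bar> \<le> e)"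
    using C(1) UA(3) by (intro exI[of _ "\<Union>p\<in>C. A p"]) auto
qed

lemma finite_subset_chain:
  fixes mx :: "'a::linorder_topology"
  assumes K: "compact (UNIV :: 'a set)" and mx: "\<And>x. x \<le> mx" and "finite T"
  obtains t :: "nat \<Rightarrow> 'a" and n where "t 0 = kmin" "t n = mx" "\<And>j. j < n \<Longrightarrow> t j < t (Suc j)" "\<And>j. j < n \<Longrightarrow> T \<inter> {t j<..<t (Suc j)} = {}"
proof -
  define l where "l = sorted_list_of_set (T \<union> {kmin, mx})"
  \<comment> \<open>The list has \<open>n + 1\<close> entries and so \<open>n\<close> steps;
    \<open>n = 0\<close> occurs on a one-point line.\<close>
  define n where "n = length l - 1"
  have set_l: "set l = T \<union> {kmin, mx}" unfolding l_def using \<open>finite T\<close> by (intro set_sorted_list_of_set) simp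
  then have "l \<noteq> []" by auto
  then have len: "length l = Suc n" by (simp add: n_def)
  have sorted: "l ! i < l ! j" if "i < j" "j \<le> n" for i j
    using strict_sorted_list_of_set[of "T \<union> {kmin, mx}"] that len
    unfolding l_def[symmetric] by (intro sorted_wrt_nth_less[of "(<)"]) auto
  have img: "(!) l ` {..n} = set l"
    using len by (auto simp: set_conv_nth less_Suc_eq_le)
  have le: "l ! i \<le> l ! j" if "i \<le> j" "j \<le> n" for i j
    using sorted[of i j] that by (cases "i = j") auto
  show ?thesis
  proof (rule that)
    show "l ! 0 = kmin"
    proof -
      obtain i where "i \<le> n" "l ! i = kmin" using img set_l by (metis UnCI atMost_iff imageE insertI1)
      then show ?thesis using le[of 0 i] kmin_le[OF K, of "l ! 0"] by auto
    qed
    show "l ! n = mx"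
    proof -
      obtain i where "i \<le> n" "l ! i = mx"
        using img set_l by (metis UnCI atMost_iff imageE insertI1 insert_commute)
      then show ?thesis using le[of i n] mx[of "l ! n"] by auto
    qed
    show "l ! j < l ! Suc j" if "j < n" for j using sorted that by auto
    show "T \<inter> {l ! j<..<l ! Suc j} = {}" if "j < n" for j
    proof -
      have False if "s \<in> T" "l ! j < s" "s < l ! Suc j" for s
      proof -
        obtain i where "i \<le> n" "s = l ! i" using img set_l \<open>s \<in> T\<close> by blast
        then show False using le[of i j] le[of "Suc j" i] that \<open>j < n\<close> by (cases "i \<le> j") auto
      qed
      then show ?thesis by auto
    qed
  qed
qed

lemma step_approximable_chain:
  fixes g :: "'a::linorder_topology \<Rightarrow> real"
  assumes K: "compact (UNIV :: 'a set)" and mx: "\<And>x. x \<le> (mx::'a)"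
    and g: "step_approximable g" and "0 < e"
  obtains t :: "nat \<Rightarrow> 'a" and n where "t 0 = kmin" "t n = mx" "\<And>j. j < n \<Longrightarrow> t j < t (Suc j)"
    "\<And>j x. j < n \<Longrightarrow> t j < x \<Longrightarrow> x \<le> t (Suc j) \<Longrightarrow> \<bar>g x - g (t (Suc j))\<bar> \<le> e"
proof -
  obtain T where T: "finite T" "\<And>x y. x \<le> y \<Longrightarrow> T \<inter> {x..<y} = {} \<Longrightarrow> \<bar>g x - g y\<bar> \<le> e"
    using step_approximableE[OF g \<open>0 < e\<close>] by blast
  obtain t n where t: "t 0 = kmin" "t n = mx" "\<And>j. j < n \<Longrightarrow> t j < t (Suc j)"
    "\<And>j. j < n \<Longrightarrow> T \<inter> {t j<..<t (Suc j)} = {}"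
    using finite_subset_chain[OF K mx T(1)] by metis
  show ?thesis
  proof (rule that[OF t(1-3)])
    fix j x assume x: "j < n" "t j < x" "x \<le> t (Suc j)"
    then have "{x..<t (Suc j)} \<subseteq> {t j<..<t (Suc j)}" by auto
    then show "\<bar>g x - g (t (Suc j))\<bar> \<le> e"
      using t(4)[OF x(1)] by (intro T(2) x(3)) blast
  qed
qed

text \<open>The representing pair of measures need not be the Jordan decomposition, so this bound
  cannot be read off from the total masses.\<close>

lemma represents_bound:
  fixes g :: "'a::linorder_topology \<Rightarrow> real"
  assumes K: "compact (UNIV :: 'a set)" and rep: "represents F P N" and bv: "bounded_variation F"
    and g: "g \<in> borel_measurable borel" "step_approximable g" "\<And>x. \<bar>g x\<bar> \<le> 1"
  shows "\<bar>integral\<^sup>L P g - integral\<^sup>L N g\<bar> \<le> nbv_norm F"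
proof (rule field_le_epsilon)
  fix e :: real assume "0 < e"
  let ?m = "measure P UNIV + measure N UNIV"
  \<comment> \<open>The oscillation is chosen after the masses of this pair, so their size
    disappears with \<open>e\<close>; the \<open>+ 1\<close> guards against mass 0.\<close>
  define d where "d = e / (?m + 1)"
  have m: "0 \<le> ?m" by simp
  then have "0 < d" using \<open>0 < e\<close> unfolding d_def by (intro divide_pos_pos) linarith+
  have "d * ?m \<le> d * (?m + 1)" using \<open>0 < d\<close> by (intro mult_left_mono) auto
  also have "\<dots> = e"
  proof -
    have "?m + 1 \<noteq> 0" using m by linarith
    then show ?thesis by (simp add: d_def)
  qed
  finally have dm: "d * ?m \<le> e" .
  obtain mx :: 'a where mx: "\<And>t. t \<le> mx" using compact_line_max[OF K] by blast
  obtain t n where t: "t 0 = kmin" "t n = mx" "\<And>j. j < n \<Longrightarrow> t j < t (Suc j)"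
    "\<And>j x. j < n \<Longrightarrow> t j < x \<Longrightarrow> x \<le> t (Suc j) \<Longrightarrow> \<bar>g x - g (t (Suc j))\<bar> \<le> d"
    using step_approximable_chain[OF K mx g(2) \<open>0 < d\<close>] by metis
  let ?S = "g kmin * F kmin + (\<Sum>j<n. g (t (Suc j)) * (F (t (Suc j)) - F (t j)))"
  have "\<bar>(integral\<^sup>L P g - integral\<^sup>L N g) - ?S\<bar> \<le> d * ?m"
    using \<open>0 < d\<close> by (intro represents_step_approx[OF rep g(1,3) t(1,3) kmin_le[OF K] _ t(4)]) (auto simp: t(2) mx)
  moreover have "\<bar>?S\<bar> \<le> \<bar>F kmin\<bar> + (\<Sum>j<n. \<bar>F (t (Suc j)) - F (t j)\<bar>)"
  proof (rule order_trans[OF abs_triangle_ineq add_mono])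
    show "\<bar>g kmin * F kmin\<bar> \<le> \<bar>F kmin\<bar>"
      using g(3) by (simp add: abs_mult mult_left_le_one_le)
    show "\<bar>\<Sum>j<n. g (t (Suc j)) * (F (t (Suc j)) - F (t j))\<bar> \<le> (\<Sum>j<n. \<bar>F (t (Suc j)) - F (t j)\<bar>)"
      using g(3) by (intro order_trans[OF sum_abs] sum_mono) (simp add: abs_mult mult_left_le_one_le)
  qed
  moreover have "(\<Sum>j<n. \<bar>F (t (Suc j)) - F (t j)\<bar>) \<le> variation F"
    using bv t(3) by (rule chain_sum_le_variation)
  ultimately show "\<bar>integral\<^sup>L P g - integral\<^sup>L N g\<bar> \<le> nbv_norm F + e"
    using dm unfolding nbv_norm_def by linarith
qed

subsection \<open>Null families\<close>

lemma c0_null_cmult: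
  assumes "c0_null I a"
  shows "c0_null I (\<lambda>i. c * a i)"
  unfolding c0_null_def
proof (intro allI impI)
  fix e :: real assume "0 < e"
  then have "0 < e / (\<bar>c\<bar> + 1)" by (intro divide_pos_pos) auto
  then have "finite {i\<in>I. e / (\<bar>c\<bar> + 1) \<le> \<bar>a i\<bar>}" using assms by (auto simp: c0_null_def)
  moreover have "{i\<in>I. e \<le> \<bar>c * a i\<bar>} \<subseteq> {i\<in>I. e / (\<bar>c\<bar> + 1) \<le> \<bar>a i\<bar>}"
  proof safe
    fix i assume "e \<le> \<bar>c * a i\<bar>"
    also have "\<dots> \<le> (\<bar>c\<bar> + 1) * \<bar>a i\<bar>" unfolding abs_mult by (intro mult_right_mono) auto
    finally show "e / (\<bar>c\<bar> + 1) \<le> \<bar>a i\<bar>" by (subst pos_divide_le_eq) (auto simp: mult.commute)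
  qed
  ultimately show "finite {i\<in>I. e \<le> \<bar>c * a i\<bar>}" by (rule finite_subset[rotated])
qed

lemma c0_null_add:
  assumes "c0_null I a" "c0_null I b"
  shows "c0_null I (\<lambda>i. a i + b i)"
  unfolding c0_null_def
proof (intro allI impI)
  fix e :: real assume "0 < e"
  then have "0 < e / 2" by simp
  then have "finite ({i\<in>I. e/2 \<le> \<bar>a i\<bar>} \<union> {i\<in>I. e/2 \<le> \<bar>b i\<bar>})"
    using assms unfolding c0_null_def by blast
  then show "finite {i\<in>I. e \<le> \<bar>a i + b i\<bar>}" by (rule finite_subset[rotated]) auto
qed

lemma c0_null_sum:
  assumes "finite S" "\<And>s. s \<in> S \<Longrightarrow> c0_null I (a s)"
  shows "c0_null I (\<lambda>i. \<Sum>s\<in>S. a s i)"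
  using assms
proof (induction S rule: finite_induct)
  case empty
  then show ?case by (simp add: c0_null_def)
next
  case (insert s S)
  then show ?case by (simp add: c0_null_add)
qed

lemma c0_null_bounded:
  assumes "c0_null I a"
  obtains B where "\<And>i. i \<in> I \<Longrightarrow> \<bar>a i\<bar> \<le> B"
proof -
  let ?E = "{i\<in>I. 1 \<le> \<bar>a i\<bar>}"
  have fin: "finite ?E" using assms by (auto simp: c0_null_def)
  have "\<bar>a i\<bar> \<le> 1 + (\<Sum>i\<in>?E. \<bar>a i\<bar>)" if "i \<in> I" for i
  proof (cases "i \<in> ?E")
    case True
    then have "\<bar>a i\<bar> \<le> (\<Sum>i\<in>?E. \<bar>a i\<bar>)" using fin by (intro member_le_sum) auto
    then show ?thesis by simp
  next
    case False
    then have "\<bar>a i\<bar> \<le> 1" using that by simp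
    moreover have "0 \<le> (\<Sum>i\<in>?E. \<bar>a i\<bar>)" by (intro sum_nonneg) auto
    ultimately show ?thesis by linarith
  qed
  then show ?thesis using that by blast
qed

section \<open>Sufficiency of the three conditions\<close>

lemma summation_by_parts:
  fixes f F :: "nat \<Rightarrow> real"
  shows "f 0 * F 0 + (\<Sum>j<n. f (Suc j) * (F (Suc j) - F j)) = (\<Sum>j<n. (f j - f (Suc j)) * F j) + f n * F n"
  by (induction n) (auto simp: algebra_simps)

lemma chain_less:
  fixes t :: "nat \<Rightarrow> 'a::preorder"
  assumes "\<And>j. j < n \<Longrightarrow> t j < t (Suc j)" "i < j" "j \<le> n"
  shows "t i < t j"
  using assms(2,3)
proof (induction j)
  case (Suc j)
  then show ?case using assms(1)[of j] by (cases "i = j") (auto intro: less_trans)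
qed simp

lemma right_isolated_max: "(\<And>x. x \<le> mx) \<Longrightarrow> right_isolated mx"
  by (simp add: right_isolated_def not_less)

text \<open>The oscillation bound omits the left end \<open>a\<close>. As \<open>a\<close> is not
  right-isolated, some \<open>x\<close> in the cell is close enough to \<open>a\<close> for
  continuity to give \<open>\<bar>f x - f a\<bar> < d\<close>, and the bound applies to
  \<open>x\<close>.\<close>

lemma small_jump:
  fixes f :: "'a::linorder_topology \<Rightarrow> real"
  assumes f: "continuous_on UNIV f" and "a < b" "0 < d" and iso: "\<not> right_isolated a"
    and osc: "\<And>x. a < x \<Longrightarrow> x \<le> b \<Longrightarrow> \<bar>f x - f b\<bar> \<le> d"
  shows "\<bar>f a - f b\<bar> \<le> 2 * d"
proof -
  have "open {z. \<bar>f z - f a\<bar> < d}"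
    by (intro open_Collect_less continuous_intros f)
  then obtain c where c: "a < c" "{a..<c} \<subseteq> {z. \<bar>f z - f a\<bar> < d}"
    using open_right[of "{z. \<bar>f z - f a\<bar> < d}" a b] \<open>a < b\<close> \<open>0 < d\<close> by auto
  have "{a<..<min b c} \<noteq> {}"
    using iso \<open>a < b\<close> \<open>a < c\<close> unfolding right_isolated_def by (meson min_less_iff_conj)
  then obtain x where "a < x" "x < b" "x < c" by auto
  then have "x \<in> {a..<c}" by simp
  then have "\<bar>f x - f a\<bar> < d" using c(2) by blast
  moreover have "\<bar>f x - f b\<bar> \<le> d" using osc[of x] \<open>a < x\<close> \<open>x < b\<close> by simp
  ultimately show ?thesis by linarith
qed

lemma compact_bounded_continuous:
  fixes f :: "'a::topological_space \<Rightarrow> real"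
  assumes K: "compact (UNIV :: 'a set)" and f: "continuous_on UNIV f"
  obtains B where "\<And>x. \<bar>f x\<bar> \<le> B"
proof -
  have "compact (range f)" using f K by (rule compact_continuous_image)
  then have "bounded (range f)" by (rule compact_imp_bounded)
  then show ?thesis using that by (auto simp: bounded_iff)
qed

lemma weak_star_nullI:
  fixes F :: "'i \<Rightarrow> 'a::linorder_topology \<Rightarrow> real" and k M :: real
  assumes K: "compact (UNIV :: 'a set)" and NBV: "\<And>i. i \<in> I \<Longrightarrow> F i \<in> NBV"
    and bdd: "\<And>i. i \<in> I \<Longrightarrow> nbv_norm (F i) \<le> M"
    and iso: "\<And>t. right_isolated t \<Longrightarrow> c0_null I (\<lambda>i. F i t)"
    and "0 \<le> k" and sums: "\<And>S. finite S \<Longrightarrow> le_mod_c0 I (\<lambda>i. \<Sum>t\<in>S. \<bar>F i t\<bar>) (\<lambda>i. k)"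
  shows "weak_star_null I F"
proof -
  have "\<forall>i\<in>I. \<exists>PN. represents (F i) (fst PN) (snd PN) \<and>
      measure (fst PN) UNIV + measure (snd PN) UNIV \<le> 3 * nbv_norm (F i)"
    using NBV_represents[OF K NBV] by (metis fst_conv snd_conv)
  then obtain PN where PN: "\<And>i. i \<in> I \<Longrightarrow> represents (F i) (fst (PN i)) (snd (PN i))"
    "\<And>i. i \<in> I \<Longrightarrow> measure (fst (PN i)) UNIV + measure (snd (PN i)) UNIV \<le> 3 * nbv_norm (F i)"
    by metis
  define P N where "P i = fst (PN i)" and "N i = snd (PN i)" for i
  have rep: "represents (F i) (P i) (N i)"
    and mass: "measure (P i) UNIV + measure (N i) UNIV \<le> 3 * \<bar>M\<bar>" if "i \<in> I" for i
    using PN[OF that] bdd[OF that] by (auto simp: P_def N_def)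
  obtain mx :: 'a where mx: "\<And>t. t \<le> mx" using compact_line_max[OF K] by blast
  have "c0_null I (\<lambda>i. integral\<^sup>L (P i) f - integral\<^sup>L (N i) f)" if f: "continuous_on UNIV f" for f
    unfolding c0_null_def
  proof (intro allI impI)
    fix e :: real assume "0 < e"
    \<comment> \<open>The term \<open>3 * \<bar>M\<bar>\<close> bounds the masses in the
      approximation error; \<open>2 * (k + 1)\<close> comes from jumps of size at most
      \<open>2 * d\<close> against a sum below \<open>k + 1\<close>. Together they use
      \<open>e/2\<close>, leaving \<open>e/2\<close> for \<open>Z\<close>.\<close>
    define d where "d = e / (2 * (3 * \<bar>M\<bar> + 2 * (k + 1)))"
    have pos: "0 < 3 * \<bar>M\<bar> + 2 * (k + 1)" using \<open>0 \<le> k\<close> by (intro add_nonneg_pos) auto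
    then have "0 < d" using \<open>0 < e\<close> unfolding d_def by (intro divide_pos_pos mult_pos_pos) auto
    have "d * (3 * \<bar>M\<bar> + 2 * (k + 1)) = e / 2"
      using pos unfolding d_def by (metis divide_divide_eq_left less_irrefl mult.commute nonzero_mult_div_cancel_left times_divide_eq_right)
    then have d_eq: "d * (3 * \<bar>M\<bar>) + 2 * d * (k + 1) = e / 2" by (simp add: algebra_simps)
    \<comment> \<open>The chain depends on \<open>f\<close> and \<open>e\<close> but not on
      \<open>i\<close>; hence (b) and (c) are used at finitely many points only.\<close>
    obtain t n where t: "t 0 = kmin" "t n = mx" "\<And>j. j < n \<Longrightarrow> t j < t (Suc j)"
      "\<And>j x. j < n \<Longrightarrow> t j < x \<Longrightarrow> x \<le> t (Suc j) \<Longrightarrow> \<bar>f x - f (t (Suc j))\<bar> \<le> d"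
      using step_approximable_chain[OF K mx continuous_step_approximable[OF K f] \<open>0 < d\<close>] by metis
    \<comment> \<open>Right-isolated nodes may carry large jumps of \<open>f\<close>. They go into
      \<open>Z\<close> together with the boundary term at \<open>mx\<close>, which is right-isolated
      too, so (b) makes \<open>Z\<close> null.\<close>
    define R where "R = {j. j < n \<and> right_isolated (t j)}"
    define Z where "Z i = (\<Sum>j\<in>R. (f (t j) - f (t (Suc j))) * F i (t j)) + f (t n) * F i (t n)" for i
    have "c0_null I Z"
      unfolding Z_def
      by (intro c0_null_add c0_null_sum c0_null_cmult iso) (auto simp: R_def t(2) right_isolated_max mx)
    then have fin1: "finite {i\<in>I. e/2 \<le> \<bar>Z i\<bar>}" using \<open>0 < e\<close> unfolding c0_null_def by (metis half_gt_zero)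
    have fin2: "finite {i\<in>I. k + 1 \<le> (\<Sum>s\<in>t ` {..<n}. \<bar>F i s\<bar>)}"
      using sums[of "t ` {..<n}"] unfolding le_mod_c0_def by (meson finite_imageI finite_lessThan zero_less_one)
    \<comment> \<open>Condition (c) sums over a set of points, the estimate over indices of the
      chain.\<close>
    have "inj_on t {..<n}"
    proof (rule linorder_inj_onI)
      fix i j assume "i < j" "i \<in> {..<n}" "j \<in> {..<n}"
      then have "t i < t j" using chain_less[of n t i j] t(3) by simp
      then show "t i \<noteq> t j" by simp
    qed auto
    then have reindex: "(\<Sum>s\<in>t ` {..<n}. \<bar>F i s\<bar>) = (\<Sum>j<n. \<bar>F i (t j)\<bar>)" for i
      by (simp add: sum.reindex)
    have f_meas: "f \<in> borel_measurable borel" using f by (rule borel_measurable_continuous_onI)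
    obtain B where B: "\<And>x. \<bar>f x\<bar> \<le> B" using compact_bounded_continuous[OF K f] by blast
    have small: "\<bar>integral\<^sup>L (P i) f - integral\<^sup>L (N i) f\<bar> < e"
      if i: "i \<in> I" "\<bar>Z i\<bar> < e/2" "(\<Sum>j<n. \<bar>F i (t j)\<bar>) < k + 1" for i
    proof -
      let ?A = "\<Sum>j<n. (f (t j) - f (t (Suc j))) * F i (t j)"
      have "\<bar>(integral\<^sup>L (P i) f - integral\<^sup>L (N i) f) - (f kmin * F i kmin +
          (\<Sum>j<n. f (t (Suc j)) * (F i (t (Suc j)) - F i (t j))))\<bar> \<le> d * (measure (P i) UNIV + measure (N i) UNIV)"
        using \<open>0 < d\<close> mx by (intro represents_step_approx[OF rep[OF i(1)] f_meas B t(1,3) kmin_le[OF K] _ t(4)])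
          (auto simp: t(2))
      also have "\<dots> \<le> d * (3 * \<bar>M\<bar>)" using mass[OF i(1)] \<open>0 < d\<close> by (intro mult_left_mono) auto
      finally have 1: "\<bar>(integral\<^sup>L (P i) f - integral\<^sup>L (N i) f) - (?A + f (t n) * F i (t n))\<bar> \<le> d * (3 * \<bar>M\<bar>)"
        using summation_by_parts[of "\<lambda>j. f (t j)" "\<lambda>j. F i (t j)" n] by (simp add: t(1))
      have "?A = (\<Sum>j\<in>R. (f (t j) - f (t (Suc j))) * F i (t j))
          + (\<Sum>j\<in>{..<n} - R. (f (t j) - f (t (Suc j))) * F i (t j))"
        by (subst add.commute, rule sum.subset_diff) (auto simp: R_def)
      moreover have "\<bar>\<Sum>j\<in>{..<n} - R. (f (t j) - f (t (Suc j))) * F i (t j)\<bar> \<le> 2 * d * (\<Sum>j<n. \<bar>F i (t j)\<bar>)"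
      proof -
        have "\<bar>\<Sum>j\<in>{..<n} - R. (f (t j) - f (t (Suc j))) * F i (t j)\<bar> \<le>
            (\<Sum>j\<in>{..<n} - R. \<bar>f (t j) - f (t (Suc j))\<bar> * \<bar>F i (t j)\<bar>)"
          unfolding abs_mult[symmetric] by (rule sum_abs)
        also have "\<dots> \<le> (\<Sum>j\<in>{..<n} - R. 2 * d * \<bar>F i (t j)\<bar>)"
          using t(3,4) \<open>0 < d\<close>
          by (intro sum_mono mult_right_mono small_jump[OF f]) (auto simp: R_def)
        also have "\<dots> \<le> (\<Sum>j<n. 2 * d * \<bar>F i (t j)\<bar>)"
          using \<open>0 < d\<close> by (intro sum_mono2) auto
        also have "\<dots> = 2 * d * (\<Sum>j<n. \<bar>F i (t j)\<bar>)" by (rule sum_distrib_left[symmetric])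
        finally show ?thesis .
      qed
      moreover have "2 * d * (\<Sum>j<n. \<bar>F i (t j)\<bar>) \<le> 2 * d * (k + 1)"
        using i(3) \<open>0 < d\<close> by (intro mult_left_mono) auto
      ultimately show ?thesis using 1 d_eq i(2) unfolding Z_def by linarith
    qed
    have "{i\<in>I. e \<le> \<bar>integral\<^sup>L (P i) f - integral\<^sup>L (N i) f\<bar>} \<subseteq>
        {i\<in>I. e/2 \<le> \<bar>Z i\<bar>} \<union> {i\<in>I. k + 1 \<le> (\<Sum>s\<in>t ` {..<n}. \<bar>F i s\<bar>)}"
      unfolding reindex using small by (auto simp: not_le[symmetric])
    with fin1 fin2 show "finite {i\<in>I. e \<le> \<bar>integral\<^sup>L (P i) f - integral\<^sup>L (N i) f\<bar>}"
      by (meson finite_UnI finite_subset)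
  qed
  then show ?thesis unfolding weak_star_null_def using rep by blast
qed

subsection \<open>Uniform boundedness\<close>

text \<open>The closed sets \<open>E n\<close> cover the complete space, so by Baire one of them
  contains a ball; linearity carries the bound from this ball to the unit ball.\<close>

lemma uniform_boundedness:
  fixes T :: "'i \<Rightarrow> 'b::real_normed_vector \<Rightarrow> 'c::real_normed_vector"
  assumes complete: "uniform_space_class.complete (UNIV :: 'b set)"
    and T: "\<And>i. i \<in> I \<Longrightarrow> bounded_linear (T i)"
    and pointwise: "\<And>x. \<exists>B. \<forall>i\<in>I. norm (T i x) \<le> B"
  obtains B where "\<And>i x. i \<in> I \<Longrightarrow> norm x \<le> 1 \<Longrightarrow> norm (T i x) \<le> B"
proof -
  define E where "E n = (\<Inter>i\<in>I. {x. norm (T i x) \<le> real n})" for n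
  have closed_E: "closed (E n)" for n
    unfolding E_def using T
    by (intro closed_INT ballI closed_Collect_le continuous_intros)
      (auto intro: linear_continuous_on)
  have "(\<Union>n. E n) = UNIV"
  proof (intro equalityI subset_UNIV subsetI)
    fix x
    obtain B where B: "\<forall>i\<in>I. norm (T i x) \<le> B" using pointwise by blast
    obtain n where "B \<le> real n" using real_arch_simple by blast
    then have "x \<in> E n" using B by (auto simp: E_def intro: order_trans)
    then show "x \<in> (\<Union>n. E n)" by blast
  qed
  have "\<exists>n. interior (E n) \<noteq> {}"
  proof (rule ccontr)
    assume "\<nexists>n. interior (E n) \<noteq> {}"
    then have "interior (\<Union>(range E)) = {}"
      using Baire_category_alt[of "euclidean :: 'b topology" "range E"] closed_E complete
        Met_TC.completely_metrizable_space_mtopology[where 'a = 'b]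
      by auto
    then show False using \<open>(\<Union>n. E n) = UNIV\<close> by simp
  qed
  then obtain n x0 r where "0 < r" and ball: "ball x0 r \<subseteq> E n"
    by (metis all_not_in_conv mem_interior)
  have "norm (T i x) \<le> 4 * real n / r" if i: "i \<in> I" and x: "norm x \<le> 1" for i x
  proof -
    interpret bounded_linear "T i" by (rule T[OF i])
    \<comment> \<open>The radius \<open>r/2\<close> keeps \<open>?y\<close> inside the open ball.
      Two bounds by \<open>n\<close> and the rescaling by \<open>2/r\<close> give
      \<open>4 * n / r\<close>.\<close>
    let ?y = "x0 + (r/2) *\<^sub>R x"
    have "norm ((r/2) *\<^sub>R x) \<le> r / 2" using x \<open>0 < r\<close> by simp
    then have "?y \<in> ball x0 r" "x0 \<in> ball x0 r" using \<open>0 < r\<close> by (auto simp: dist_norm)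
    then have "norm (T i ?y) \<le> n" "norm (T i x0) \<le> n" using ball i unfolding E_def by blast+
    moreover have "T i x = (2/r) *\<^sub>R (T i ?y - T i x0)"
      using \<open>0 < r\<close> by (simp add: add scaleR)
    ultimately have le: "norm (T i ?y - T i x0) \<le> 2 * real n"
      and eq: "norm (T i x) = (2/r) * norm (T i ?y - T i x0)"
      using \<open>0 < r\<close> norm_triangle_ineq4[of "T i ?y" "T i x0"] by (linarith, simp)
    have "(2/r) * norm (T i ?y - T i x0) \<le> (2/r) * (2 * real n)"
      using le \<open>0 < r\<close> by (intro mult_left_mono) auto
    then show ?thesis unfolding eq by simp
  qed
  then show ?thesis using that by blast
qed

text \<open>The library has this only over a metric domain.\<close>

lemma complete_bcontfun: "uniform_space_class.complete (UNIV :: ('a::topological_space \<Rightarrow>\<^sub>C 'b::complete_space) set)"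
  unfolding complete_def
proof safe
  fix f :: "nat \<Rightarrow> 'a \<Rightarrow>\<^sub>C 'b" assume "Cauchy f"
  then have "uniformly_Cauchy_on UNIV (\<lambda>n. apply_bcontfun (f n))"
    unfolding Cauchy_def uniformly_Cauchy_on_def by (meson dist_fun_lt_imp_dist_val_lt)
  then obtain g where "uniform_limit UNIV (\<lambda>n. apply_bcontfun (f n)) g sequentially"
    using Cauchy_uniformly_convergent unfolding uniformly_convergent_on_def by blast
  from uniform_limit_bcontfunE[OF this sequentially_bot] show "\<exists>l\<in>UNIV. f \<longlonglongrightarrow> l" by blast
qed

section \<open>The NBV norm as a dual norm on continuous functions\<close>

lemma compact_Urysohn:
  fixes S T :: "'a::t2_space set"
  assumes "compact (UNIV :: 'a set)" "closed S" "closed T" "S \<inter> T = {}"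
  obtains f :: "'a \<Rightarrow> real" where "continuous_on UNIV f" "\<And>x. 0 \<le> f x" "\<And>x. f x \<le> 1"
    "\<And>x. x \<in> S \<Longrightarrow> f x = 1" "\<And>x. x \<in> T \<Longrightarrow> f x = 0"
proof -
  have "Hausdorff_space (euclidean :: 'a topology)"
    unfolding Hausdorff_space_def by (metis disjnt_def hausdorff open_openin)
  moreover have "compact_space (euclidean :: 'a topology)"
    using assms(1) by (simp add: compact_space_def)
  ultimately have "normal_space (euclidean :: 'a topology)"
    by (intro compact_Hausdorff_or_regular_imp_normal_space) auto
  moreover have "disjnt T S" using assms(4) by (auto simp: disjnt_def)
  ultimately obtain f where f: "continuous_map (euclidean :: 'a topology) (top_of_set {0..1::real}) f"
    "f ` T \<subseteq> {0}" "f ` S \<subseteq> {1}"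
    \<comment> \<open>The set listed first is sent to the left endpoint 0, hence the order
      \<open>T S\<close>.\<close>
    using Urysohn_lemma[of "euclidean :: 'a topology" T S 0 1] assms(2,3) by auto
  then have "continuous_on UNIV f" "range f \<subseteq> {0..1}"
    by (auto simp: continuous_map_in_subtopology)
  with f(2,3) show ?thesis by (intro that[of f]) (auto simp: image_subset_iff)
qed

lemma regular_borel_measure_outer:
  assumes M: "regular_borel_measure M" and A: "A \<in> sets borel" and "0 < e"
  obtains U where "open U" "A \<subseteq> U" "measure M (U - A) \<le> e"
proof -
  interpret finite_measure M using M by (simp add: regular_borel_measure_def)
  have sets_M [simp]: "sets M = sets borel" using M by (simp add: regular_borel_measure_def)
  have "emeasure M A = (INF U\<in>{U. open U \<and> A \<subseteq> U}. emeasure M U)"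
    using M A unfolding regular_borel_measure_def by blast
  moreover have "emeasure M A < emeasure M A + ennreal e"
    using \<open>0 < e\<close> by (simp add: emeasure_eq_measure ennreal_plus[symmetric] del: ennreal_plus)
      (simp add: ennreal_less_iff)
  ultimately have "(INF U\<in>{U. open U \<and> A \<subseteq> U}. emeasure M U) < emeasure M A + ennreal e" by metis
  then obtain U where U: "open U" "A \<subseteq> U" "emeasure M U < emeasure M A + ennreal e"
    by (auto simp: INF_less_iff)
  then have "measure M U \<le> measure M A + e"
    using \<open>0 < e\<close> by (simp add: emeasure_eq_measure ennreal_plus[symmetric] ennreal_less_iff del: ennreal_plus)
  moreover have "measure M (U - A) = measure M U - measure M A"
    using U A by (intro finite_measure_Diff) auto
  ultimately show ?thesis using U by (intro that[of U]) auto
qed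

text \<open>One function has to serve both measures: it is 1 on \<open>{..s}\<close> and 0 off
  \<open>U \<inter> V\<close>, with one open set supplied by the outer regularity of each measure.
  The error lives on the thin set between.\<close>

lemma atMost_L1_approx:
  fixes s :: "'a::linorder_topology"
  assumes K: "compact (UNIV :: 'a set)" and rep: "represents F P N" and "0 < e"
  obtains f :: "'a \<Rightarrow> real" where "continuous_on UNIV f" "\<And>x. 0 \<le> f x" "\<And>x. f x \<le> 1"
    "(\<integral>x. \<bar>f x - indicator {..s} x\<bar> \<partial>P) \<le> e" "(\<integral>x. \<bar>f x - indicator {..s} x\<bar> \<partial>N) \<le> e"
proof -
  have reg: "regular_borel_measure P" "regular_borel_measure N" using rep by (auto simp: represents_def)
  obtain U where U: "open U" "{..s} \<subseteq> U" "measure P (U - {..s}) \<le> e"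
    using regular_borel_measure_outer[OF reg(1) _ \<open>0 < e\<close>] by (metis atMost_borel)
  obtain V where V: "open V" "{..s} \<subseteq> V" "measure N (V - {..s}) \<le> e"
    using regular_borel_measure_outer[OF reg(2) _ \<open>0 < e\<close>] by (metis atMost_borel)
  obtain f :: "'a \<Rightarrow> real" where f: "continuous_on UNIV f" "\<And>x. 0 \<le> f x" "\<And>x. f x \<le> 1"
    "\<And>x. x \<in> {..s} \<Longrightarrow> f x = 1" "\<And>x. x \<in> - (U \<inter> V) \<Longrightarrow> f x = 0"
    using compact_Urysohn[OF K, of "{..s}" "- (U \<inter> V)"] U V by (auto simp: closed_Compl open_Int)
  have le: "(\<integral>x. \<bar>f x - indicator {..s} x\<bar> \<partial>M) \<le> measure M (W - {..s})"
    if M: "finite_measure M" "sets M = sets borel" and W: "open W" "U \<inter> V \<subseteq> W" for M W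
  proof -
    interpret finite_measure M by (rule M)
    have [simp]: "space M = UNIV" using sets_eq_imp_space_eq[OF M(2)] by simp
    have m: "W - {..s} \<in> sets M" using W M(2) by auto
    have "\<bar>f x - indicator {..s} x\<bar> \<le> 1" for x
      using f(2,3)[of x] by (auto simp: indicator_def)
    then have "integrable M (\<lambda>x. \<bar>f x - indicator {..s} x\<bar>)"
      by (intro bounded_borel_integrable[OF M, of _ 1] borel_measurable_abs borel_measurable_diff
          borel_measurable_continuous_onI f(1) borel_measurable_indicator) auto
    moreover have "\<bar>f x - indicator {..s} x\<bar> \<le> indicator (W - {..s}) x" for x
      using f(2,3)[of x] f(4,5)[of x] W(2) by (cases "x \<le> s"; cases "x \<in> W") (auto simp: indicator_def)
    ultimately have "(\<integral>x. \<bar>f x - indicator {..s} x\<bar> \<partial>M) \<le> (\<integral>x. indicator (W - {..s}) x \<partial>M)"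
      using m by (intro integral_mono integrable_real_indicator) (auto simp: emeasure_eq_measure)
    then show ?thesis by simp
  qed
  show ?thesis
  proof (rule that[OF f(1-3)])
    show "(\<integral>x. \<bar>f x - indicator {..s} x\<bar> \<partial>P) \<le> e"
      using le[OF represents_finite_measure(1,3)[OF rep] U(1)] U(3) by simp
    show "(\<integral>x. \<bar>f x - indicator {..s} x\<bar> \<partial>N) \<le> e"
      using le[OF represents_finite_measure(2,4)[OF rep] V(1)] V(3) by simp
  qed
qed

text \<open>For each chain a step function with values in \<open>{-1..1}\<close>, built from the
  signs of the increments, integrates exactly to \<open>\<bar>F kmin\<bar>\<close> plus the chain
  sum. Continuous functions bounded by 1 approximate it in mean for both measures.\<close>

lemma nbv_norm_le:
  fixes F :: "'a::linorder_topology \<Rightarrow> real"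
  assumes K: "compact (UNIV :: 'a set)" and rep: "represents F P N"
    and B: "\<And>f. continuous_on UNIV f \<Longrightarrow> (\<And>x. \<bar>f x\<bar> \<le> 1) \<Longrightarrow> \<bar>integral\<^sup>L P f - integral\<^sup>L N f\<bar> \<le> B"
  shows "nbv_norm F \<le> B"
proof -
  have chain: "\<bar>F kmin\<bar> + (\<Sum>j<n. \<bar>F (t (Suc j)) - F (t j)\<bar>) \<le> B"
    if t: "\<And>j. j < n \<Longrightarrow> t j < t (Suc j)" for t n
  proof (rule field_le_epsilon)
    fix e :: real assume "0 < e"
    \<comment> \<open>There is one approximant for \<open>kmin\<close> and there are two per step,
      each costing \<open>d\<close> under \<open>P\<close> and again under \<open>N\<close>.\<close>
    define d where "d = e / (2 * (1 + 2 * real n))"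
    have "0 < d" using \<open>0 < e\<close> by (auto simp: d_def intro!: divide_pos_pos)
    have d_eq: "2 * ((1 + 2 * real n) * d) = e"
    proof -
      have "1 + 2 * real n \<noteq> 0" by linarith
      then show ?thesis by (simp add: d_def field_simps)
    qed
    have "\<exists>f. continuous_on UNIV f \<and> (\<forall>x. 0 \<le> f x) \<and> (\<forall>x. f x \<le> (1::real)) \<and>
        (\<integral>x. \<bar>f x - indicator {..s} x\<bar> \<partial>P) \<le> d \<and> (\<integral>x. \<bar>f x - indicator {..s} x\<bar> \<partial>N) \<le> d" for s
      by (rule atMost_L1_approx[OF K rep \<open>0 < d\<close>, of s]) blast
    then obtain \<phi> where "\<forall>s. continuous_on UNIV (\<phi> s) \<and> (\<forall>x. 0 \<le> \<phi> s x) \<and> (\<forall>x. \<phi> s x \<le> (1::real)) \<and>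
        (\<integral>x. \<bar>\<phi> s x - indicator {..s} x\<bar> \<partial>P) \<le> d \<and> (\<integral>x. \<bar>\<phi> s x - indicator {..s} x\<bar> \<partial>N) \<le> d"
      using choice[of "\<lambda>s f. continuous_on UNIV f \<and> (\<forall>x. 0 \<le> f x) \<and> (\<forall>x. f x \<le> (1::real)) \<and>
        (\<integral>x. \<bar>f x - indicator {..s} x\<bar> \<partial>P) \<le> d \<and> (\<integral>x. \<bar>f x - indicator {..s} x\<bar> \<partial>N) \<le> d"] by blast
    then have \<phi>: "\<And>s. continuous_on UNIV (\<phi> s)" "\<And>s x. 0 \<le> \<phi> s x" "\<And>s x. \<phi> s x \<le> 1"
      "\<And>s. (\<integral>x. \<bar>\<phi> s x - indicator {..s} x\<bar> \<partial>P) \<le> d" "\<And>s. (\<integral>x. \<bar>\<phi> s x - indicator {..s} x\<bar> \<partial>N) \<le> d"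
      by blast+
    define c where "c j = sgn (F (t (Suc j)) - F (t j))" for j
    \<comment> \<open>The family \<open>u\<close> is a parameter so that the exact indicators and
      their continuous approximants can be put into the same expression.\<close>
    define G where "G u x = sgn (F kmin) * u kmin x + (\<Sum>j<n. c j * (u (t (Suc j)) x - u (t j) x))"
      for u :: "'a \<Rightarrow> 'a \<Rightarrow> real" and x
    let ?ind = "\<lambda>s. indicator {..s} :: 'a \<Rightarrow> real"
    \<comment> \<open>The combination \<open>G \<phi>\<close> may leave \<open>{-1..1}\<close>.
      Clipping restores the bound and brings it no farther from \<open>G ?ind\<close>, whose values
      already lie there.\<close>
    define f where "f x = max (- 1) (min 1 (G \<phi> x))" for x
    have c: "\<bar>c j\<bar> \<le> 1" for j by (simp add: c_def sgn_if)
    have g_le: "\<bar>G ?ind x\<bar> \<le> 1" for x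
    proof -
      let ?g = "\<lambda>n. sgn (F kmin) * ?ind kmin x + (\<Sum>j<n. c j * (?ind (t (Suc j)) x - ?ind (t j) x))"
      \<comment> \<open>The vanishing to the right of \<open>t n\<close> is what keeps the bound at
        1: a new cell starts where the previous sum is 0.\<close>
      have "\<bar>?g n\<bar> \<le> 1 \<and> (kmin < x \<longrightarrow> t n < x \<longrightarrow> ?g n = 0)"
        using t
      proof (induction n)
        case 0
        then show ?case by (auto simp: sgn_if indicator_def)
      next
        case (Suc n)
        have IH: "\<bar>?g n\<bar> \<le> 1 \<and> (kmin < x \<longrightarrow> t n < x \<longrightarrow> ?g n = 0)"
          by (rule Suc.IH) (use Suc.prems in auto)
        have eq: "?g (Suc n) = ?g n + c n * (?ind (t (Suc n)) x - ?ind (t n) x)" by simp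
        have "t n < t (Suc n)" using Suc.prems by simp
        show ?case
        proof (cases "t n < x \<and> x \<le> t (Suc n)")
          case True
          then have "kmin < x" using kmin_le[OF K, of "t n"] by auto
          then have g0: "?g n = 0" using IH True by blast
          have "?ind (t (Suc n)) x = 1" "?ind (t n) x = 0" using True by (auto simp: indicator_def not_le)
          then have "?g (Suc n) = c n" unfolding eq g0 by simp
          then show ?thesis using True c[of n] by (simp only: not_less[symmetric]) blast
        next
          case False
          then have "?ind (t (Suc n)) x - ?ind (t n) x = 0"
            using \<open>t n < t (Suc n)\<close> by (auto simp: indicator_def)
          then show ?thesis using IH \<open>t n < t (Suc n)\<close> unfolding eq by auto
        qed
      qed
      then show ?thesis by (simp add: G_def)
    qed
    have close: "\<bar>f x - G ?ind x\<bar> \<le> \<bar>\<phi> kmin x - ?ind kmin x\<bar> +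
        (\<Sum>j<n. \<bar>\<phi> (t (Suc j)) x - ?ind (t (Suc j)) x\<bar> + \<bar>\<phi> (t j) x - ?ind (t j) x\<bar>)" for x
    proof -
      have "\<bar>f x - G ?ind x\<bar> \<le> \<bar>G \<phi> x - G ?ind x\<bar>"
        using g_le[of x] unfolding f_def by linarith
      also have "G \<phi> x - G ?ind x = sgn (F kmin) * (\<phi> kmin x - ?ind kmin x) +
        (\<Sum>j<n. c j * ((\<phi> (t (Suc j)) x - ?ind (t (Suc j)) x) - (\<phi> (t j) x - ?ind (t j) x)))"
        unfolding G_def by (simp add: algebra_simps sum_subtractf sum.distrib)
      also have "\<bar>\<dots>\<bar> \<le> \<bar>\<phi> kmin x - ?ind kmin x\<bar> +
        (\<Sum>j<n. \<bar>\<phi> (t (Suc j)) x - ?ind (t (Suc j)) x\<bar> + \<bar>\<phi> (t j) x - ?ind (t j) x\<bar>)"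
      proof (rule order_trans[OF abs_triangle_ineq add_mono])
        show "\<bar>sgn (F kmin) * (\<phi> kmin x - ?ind kmin x)\<bar> \<le> \<bar>\<phi> kmin x - ?ind kmin x\<bar>"
          by (auto simp: sgn_if abs_minus_commute)
        show "\<bar>\<Sum>j<n. c j * ((\<phi> (t (Suc j)) x - ?ind (t (Suc j)) x) - (\<phi> (t j) x - ?ind (t j) x))\<bar>
          \<le> (\<Sum>j<n. \<bar>\<phi> (t (Suc j)) x - ?ind (t (Suc j)) x\<bar> + \<bar>\<phi> (t j) x - ?ind (t j) x\<bar>)"
        proof (rule order_trans[OF sum_abs sum_mono])
          fix j
          have "\<bar>c j * a\<bar> \<le> \<bar>a\<bar>" for a
            using c[of j] by (simp add: abs_mult mult_left_le_one_le)
          then show "\<bar>c j * ((\<phi> (t (Suc j)) x - ?ind (t (Suc j)) x) - (\<phi> (t j) x - ?ind (t j) x))\<bar>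
            \<le> \<bar>\<phi> (t (Suc j)) x - ?ind (t (Suc j)) x\<bar> + \<bar>\<phi> (t j) x - ?ind (t j) x\<bar>"
            by (rule order_trans) (rule abs_triangle_ineq4)
        qed
      qed
      finally show ?thesis .
    qed
    have cont_f: "continuous_on UNIV f"
      unfolding f_def G_def by (intro continuous_intros \<phi>(1))
    have f_le: "\<bar>f x\<bar> \<le> 1" for x by (auto simp: f_def)
    have ind_meas: "?ind s \<in> borel_measurable borel" for s by simp
    have G_meas: "G ?ind \<in> borel_measurable borel"
      unfolding G_def by (intro borel_measurable_add borel_measurable_sum borel_measurable_times
        borel_measurable_const borel_measurable_diff ind_meas)
    have L1: "\<bar>integral\<^sup>L M f - integral\<^sup>L M (G ?ind)\<bar> \<le> (1 + 2 * real n) * d"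
      if M: "finite_measure M" "sets M = sets borel" and int: "\<And>s. (\<integral>x. \<bar>\<phi> s x - ?ind s x\<bar> \<partial>M) \<le> d" for M
    proof -
      interpret finite_measure M by (rule M)
      have h: "integrable M (\<lambda>x. \<bar>\<phi> s x - ?ind s x\<bar>)" for s
      proof (rule bounded_borel_integrable[OF M, of _ 1])
        show "\<bar>\<bar>\<phi> s x - ?ind s x\<bar>\<bar> \<le> 1" for x
          using \<phi>(2,3)[of s x] by (auto simp: indicator_def)
        show "(\<lambda>x. \<bar>\<phi> s x - ?ind s x\<bar>) \<in> borel_measurable borel"
          using borel_measurable_continuous_onI[OF \<phi>(1)] ind_meas
          by (intro borel_measurable_abs borel_measurable_diff)
      qed
      have int_f: "integrable M f"
        using f_le by (intro bounded_borel_integrable[OF M, of _ 1] borel_measurable_continuous_onI cont_f)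
      have int_G: "integrable M (G ?ind)"
        using g_le by (intro bounded_borel_integrable[OF M, of _ 1] G_meas)
      have "\<bar>integral\<^sup>L M f - integral\<^sup>L M (G ?ind)\<bar> = \<bar>\<integral>x. f x - G ?ind x \<partial>M\<bar>"
        using int_f int_G by simp
      also have "\<dots> \<le> (\<integral>x. \<bar>f x - G ?ind x\<bar> \<partial>M)" by (rule integral_abs_bound)
      also have "\<dots> \<le> (\<integral>x. \<bar>\<phi> kmin x - ?ind kmin x\<bar> +
          (\<Sum>j<n. \<bar>\<phi> (t (Suc j)) x - ?ind (t (Suc j)) x\<bar> + \<bar>\<phi> (t j) x - ?ind (t j) x\<bar>) \<partial>M)"
        using close int_f int_G
        by (intro integral_mono integrable_abs Bochner_Integration.integrable_add
            Bochner_Integration.integrable_sum Bochner_Integration.integrable_diff h) auto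
      also have "\<dots> = (\<integral>x. \<bar>\<phi> kmin x - ?ind kmin x\<bar> \<partial>M) +
          (\<Sum>j<n. (\<integral>x. \<bar>\<phi> (t (Suc j)) x - ?ind (t (Suc j)) x\<bar> \<partial>M) + (\<integral>x. \<bar>\<phi> (t j) x - ?ind (t j) x\<bar> \<partial>M))"
        using h by (simp add: Bochner_Integration.integral_sum)
      also have "\<dots> \<le> d + (\<Sum>j<n. d + d)"
        using int by (intro add_mono sum_mono)
      also have "\<dots> = (1 + 2 * real n) * d" by (simp add: algebra_simps)
      finally show ?thesis .
    qed
    have G_int: "integral\<^sup>L M (G ?ind) = sgn (F kmin) * measure M {..kmin} +
        (\<Sum>j<n. c j * (measure M {..t (Suc j)} - measure M {..t j}))"
      if M: "finite_measure M" "sets M = sets borel" for M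
    proof -
      interpret finite_measure M by (rule M)
      have [simp]: "space M = UNIV" using sets_eq_imp_space_eq[OF M(2)] by simp
      have "integrable M (?ind s)" for s
        using M(2) by (intro integrable_real_indicator) (auto simp: emeasure_eq_measure)
      then show ?thesis unfolding G_def by (simp add: Bochner_Integration.integral_sum)
    qed
    note fin = represents_finite_measure[OF rep]
    have F_eq: "F s = measure P {..s} - measure N {..s}" for s
      using rep by (simp add: represents_def kmin_atLeastAtMost[OF K])
    have "integral\<^sup>L P (G ?ind) - integral\<^sup>L N (G ?ind) =
        sgn (F kmin) * F kmin + (\<Sum>j<n. c j * (F (t (Suc j)) - F (t j)))"
      unfolding G_int[OF fin(1,3)] G_int[OF fin(2,4)] F_eq
      by (simp add: algebra_simps sum_subtractf sum.distrib)
    also have "\<dots> = \<bar>F kmin\<bar> + (\<Sum>j<n. \<bar>F (t (Suc j)) - F (t j)\<bar>)"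
      by (simp add: c_def abs_sgn mult.commute)
    finally have "integral\<^sup>L P (G ?ind) - integral\<^sup>L N (G ?ind) = \<bar>F kmin\<bar> + (\<Sum>j<n. \<bar>F (t (Suc j)) - F (t j)\<bar>)" .
    then show "\<bar>F kmin\<bar> + (\<Sum>j<n. \<bar>F (t (Suc j)) - F (t j)\<bar>) \<le> B + e"
      using L1[OF fin(1,3) \<phi>(4)] L1[OF fin(2,4) \<phi>(5)] B[OF cont_f f_le] d_eq by linarith
  qed
  have "variation F \<le> B - \<bar>F kmin\<bar>"
    unfolding variation_def
  proof (rule cSup_least)
    show "variation_sums F \<noteq> {}"
      unfolding variation_sums_def by (auto intro!: exI[of _ "0::nat"])
    fix x assume "x \<in> variation_sums F"
    then show "x \<le> B - \<bar>F kmin\<bar>"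
      using chain by (fastforce simp: variation_sums_def algebra_simps)
  qed
  then show ?thesis by (simp add: nbv_norm_def)
qed

text \<open>Null families are bounded, so the integrals are pointwise bounded functionals on the
  bounded continuous functions; \<open>nbv_norm_le\<close> turns their uniform bound on the unit
  ball into a bound on the norms.\<close>

lemma weak_star_null_nbv_bounded:
  fixes F :: "'i \<Rightarrow> 'a::linorder_topology \<Rightarrow> real"
  assumes K: "compact (UNIV :: 'a set)" and rep: "\<And>i. i \<in> I \<Longrightarrow> represents (F i) (P i) (N i)"
    and null: "\<And>f::'a \<Rightarrow> real. continuous_on UNIV f \<Longrightarrow> c0_null I (\<lambda>i. integral\<^sup>L (P i) f - integral\<^sup>L (N i) f)"
  obtains B where "\<And>i. i \<in> I \<Longrightarrow> nbv_norm (F i) \<le> B"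
proof -
  define T where "T i f = integral\<^sup>L (P i) (apply_bcontfun f) - integral\<^sup>L (N i) (apply_bcontfun f)"
    for i and f :: "'a \<Rightarrow>\<^sub>C real"
  have bl: "bounded_linear (T i)" if "i \<in> I" for i
  proof -
    note fin = represents_finite_measure[OF rep[OF that]]
    have int: "integrable M (apply_bcontfun f)" if "finite_measure M" "sets M = sets borel"
      for M and f :: "'a \<Rightarrow>\<^sub>C real"
      using norm_bounded[of f]
      by (intro bounded_borel_integrable[OF that, of _ "norm f"] borel_measurable_continuous_onI) auto
    note int' = int[OF fin(1,3)] int[OF fin(2,4)]
    have bound: "\<bar>integral\<^sup>L M (apply_bcontfun f)\<bar> \<le> norm f * measure M UNIV"
      if M: "finite_measure M" "sets M = sets borel" for M and f :: "'a \<Rightarrow>\<^sub>C real"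
    proof -
      interpret finite_measure M by (rule M)
      have [simp]: "space M = UNIV" using sets_eq_imp_space_eq[OF M(2)] by simp
      have "\<bar>integral\<^sup>L M (apply_bcontfun f)\<bar> \<le> (\<integral>x. \<bar>apply_bcontfun f x\<bar> \<partial>M)" by (rule integral_abs_bound)
      also have "\<dots> \<le> (\<integral>x. norm f \<partial>M)"
        using norm_bounded[of f] by (intro integral_mono integrable_abs int[OF M]) auto
      finally show ?thesis by (simp add: mult.commute)
    qed
    \<comment> \<open>This mass bound depends on \<open>i\<close> and only certifies continuity of
      each functional.\<close>
    show ?thesis
    proof (rule bounded_linear_intro[where K = "measure (P i) UNIV + measure (N i) UNIV"])
      fix f g :: "'a \<Rightarrow>\<^sub>C real" and r :: real
      show "T i (f + g) = T i f + T i g" using int' by (simp add: T_def plus_bcontfun.rep_eq)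
      show "T i (r *\<^sub>R f) = r *\<^sub>R T i f" by (simp add: T_def scaleR_bcontfun.rep_eq right_diff_distrib)
      show "norm (T i f) \<le> norm f * (measure (P i) UNIV + measure (N i) UNIV)"
        using bound[OF fin(1,3), of f] bound[OF fin(2,4), of f] unfolding T_def distrib_left real_norm_def by linarith
    qed
  qed
  have "\<exists>B. \<forall>i\<in>I. norm (T i f) \<le> B" for f
  proof -
    have "c0_null I (\<lambda>i. T i f)" unfolding T_def by (rule null) simp
    from c0_null_bounded[OF this] show ?thesis by (metis real_norm_def)
  qed
  then obtain B where B: "\<And>i f. i \<in> I \<Longrightarrow> norm f \<le> 1 \<Longrightarrow> norm (T i f) \<le> B"
    using uniform_boundedness[OF complete_bcontfun, of I T] bl by metis
  have "nbv_norm (F i) \<le> B" if i: "i \<in> I" for i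
  proof (rule nbv_norm_le[OF K rep[OF i]])
    fix f :: "'a \<Rightarrow> real" assume f: "continuous_on UNIV f" "\<And>x. \<bar>f x\<bar> \<le> 1"
    then have "f \<in> bcontfun" by (intro bcontfun_normI) auto
    then have eq: "apply_bcontfun (Bcontfun f) = f" by (rule Bcontfun_inverse)
    then have "norm (Bcontfun f) \<le> 1" using f(2) by (intro norm_bound) simp
    from B[OF i this] show "\<bar>integral\<^sup>L (P i) f - integral\<^sup>L (N i) f\<bar> \<le> B"
      by (simp add: T_def eq)
  qed
  then show ?thesis using that by blast
qed

subsection \<open>Sums over finite sets\<close>

text \<open>With a gap to the right of \<open>t\<close>, or nothing there, the closed segment
  \<open>{..t}\<close> is also open and has empty frontier.\<close>

lemma continuous_indicator_right_isolated:
  fixes t :: "'a::linorder_topology"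
  assumes "right_isolated t"
  shows "continuous_on UNIV (indicator {..t} :: 'a \<Rightarrow> real)"
proof -
  have "open {..t}"
  proof (cases "\<exists>s. t < s")
    case True
    then obtain s where "s > t" "{t<..<s} = {}" using assms unfolding right_isolated_def by blast
    then have "{..t} = {..<s}" by (auto simp: not_less[symmetric])
    then show ?thesis by simp
  next
    case False
    then have "{..t} = UNIV" by (auto simp: not_less)
    then show ?thesis by simp
  qed
  then have "\<forall>x. x \<notin> frontier {..t}" by (simp add: frontier_def interior_open)
  then show ?thesis
    by (simp add: continuous_on_eq_continuous_at isCont_indicator)
qed

text \<open>Taking \<open>f s = 1\<close> up to \<open>s\<close> and \<open>f s = 0\<close> from the next point of \<open>S\<close> on, the differences
  \<open>indicator {..s} - f s\<close> have disjoint supports, so every signed sum of them is bounded by 1.\<close>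

lemma sum_abs_le_nbv_norm:
  fixes S :: "'a::linorder_topology set"
  assumes K: "compact (UNIV :: 'a set)" and "finite S"
  obtains f :: "'a \<Rightarrow> 'a \<Rightarrow> real" where "\<And>s. continuous_on UNIV (f s)"
    "\<And>F P (N :: 'a measure). represents F P N \<Longrightarrow> bounded_variation F \<Longrightarrow>
      (\<Sum>s\<in>S. \<bar>F s\<bar>) \<le> nbv_norm F + (\<Sum>s\<in>S. \<bar>integral\<^sup>L P (f s) - integral\<^sup>L N (f s)\<bar>)"
proof -
  have "\<exists>f. continuous_on UNIV f \<and> (\<forall>x. 0 \<le> f x) \<and> (\<forall>x. f x \<le> (1::real)) \<and>
      (\<forall>x\<le>s. f x = 1) \<and> (\<forall>u\<in>S. \<forall>x\<ge>u. s < u \<longrightarrow> f x = 0)" for s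
  proof -
    have "closed (\<Union>u\<in>S \<inter> {s<..}. {u..})" using \<open>finite S\<close> by (intro closed_UN) auto
    moreover have "{..s} \<inter> (\<Union>u\<in>S \<inter> {s<..}. {u..}) = {}" by auto
    ultimately obtain f :: "'a \<Rightarrow> real" where f: "continuous_on UNIV f" "\<And>x. 0 \<le> f x" "\<And>x. f x \<le> 1"
      "\<And>x. x \<in> {..s} \<Longrightarrow> f x = 1" "\<And>x. x \<in> (\<Union>u\<in>S \<inter> {s<..}. {u..}) \<Longrightarrow> f x = 0"
      using compact_Urysohn[OF K closed_atMost] by metis
    have "f x = 0" if "u \<in> S" "u \<le> x" "s < u" for u x
      using f(5)[of x] that by auto
    with f(1-4) show ?thesis by (intro exI[of _ f]) auto
  qed
  \<comment> \<open>The functions depend on \<open>S\<close> alone, before any \<open>F\<close>,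
    \<open>P\<close>, \<open>N\<close> is given; one finite set of test functions thus serves all
    indices.\<close>
  then obtain f where f: "\<And>s. continuous_on UNIV (f s)" "\<And>s x. 0 \<le> f s x" "\<And>s x. f s x \<le> (1::real)"
    "\<And>s x. x \<le> s \<Longrightarrow> f s x = 1" "\<And>s u x. u \<in> S \<Longrightarrow> u \<le> x \<Longrightarrow> s < u \<Longrightarrow> f s x = 0"
    by metis
  have "(\<Sum>s\<in>S. \<bar>F s\<bar>) \<le> nbv_norm F + (\<Sum>s\<in>S. \<bar>integral\<^sup>L P (f s) - integral\<^sup>L N (f s)\<bar>)"
    if rep: "represents F P N" and bv: "bounded_variation F" for F and P N :: "'a measure"
  proof -
    note fin = represents_finite_measure[OF rep]
    \<comment> \<open>The difference is written as a sum with factor \<open>- 1\<close> so that the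
      closure rules for \<open>step_approximable\<close> apply.\<close>
    define h where "h s x = sgn (F s) * (indicator {..s} x + (- 1) * f s x)" for s x
    define g where "g x = (\<Sum>s\<in>S. h s x)" for x
    have h_le: "\<bar>h s x\<bar> \<le> 1" for s x
      using f(2,3)[of s x] by (auto simp: h_def sgn_if indicator_def)
    have h_zero: "h s x = 0" if "x \<le> s \<or> (\<exists>u\<in>S. u \<le> x \<and> s < u)" for s x
      using that f(4)[of x s] f(5)[of _ x s] by (auto simp: h_def indicator_def)
    have g_le: "\<bar>g x\<bar> \<le> 1" for x
    \<comment> \<open>At most one term is nonzero at \<open>x\<close>: if \<open>u < s < x\<close>
      with \<open>s\<close> in \<open>S\<close>, then both the indicator and \<open>f u\<close>
      vanish at \<open>x\<close>.\<close>
    proof (cases "\<exists>s\<in>S. h s x \<noteq> 0")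
      case True
      then obtain s where s: "s \<in> S" "h s x \<noteq> 0" by blast
      have "h u x = 0" if "u \<in> S - {s}" for u
      proof (rule ccontr)
        assume u: "h u x \<noteq> 0"
        consider "u < s" | "s < u" using \<open>u \<in> S - {s}\<close> by (auto simp: neq_iff)
        moreover have "s < x" "u < x" using h_zero s(2) u by (meson not_le)+
        ultimately show False
          using h_zero s u \<open>u \<in> S - {s}\<close> by cases (meson DiffD1 less_imp_le)+
      qed
      then have "g x = h s x"
        unfolding g_def using sum.remove[OF \<open>finite S\<close> s(1), of "\<lambda>s. h s x"] by simp
      then show ?thesis using h_le by simp
    qed (simp add: g_def)
    have h_meas: "h s \<in> borel_measurable borel" for s
      unfolding h_def using f(1)[of s]
      by (intro borel_measurable_times borel_measurable_add borel_measurable_const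
          borel_measurable_continuous_onI borel_measurable_indicator) auto
    have bound: "\<bar>integral\<^sup>L P g - integral\<^sup>L N g\<bar> \<le> nbv_norm F"
    proof (rule represents_bound[OF K rep bv _ _ g_le])
      show "g \<in> borel_measurable borel" unfolding g_def by (intro borel_measurable_sum h_meas)
      show "step_approximable g"
        unfolding g_def h_def
        by (intro step_approximable_sum step_approximable_cmult step_approximable_add \<open>finite S\<close>
          step_approximable_indicator continuous_step_approximable[OF K] f(1))
    qed
    have "integral\<^sup>L M g = (\<Sum>s\<in>S. sgn (F s) * (measure M {..s} - integral\<^sup>L M (f s)))"
      if M: "finite_measure M" "sets M = sets borel" for M
    proof -
      interpret finite_measure M by (rule M)
      have [simp]: "space M = UNIV" using sets_eq_imp_space_eq[OF M(2)] by simp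
      have "integrable M (f s)" for s
        using f(2,3)[of s] by (intro bounded_borel_integrable[OF M, of _ 1] borel_measurable_continuous_onI f(1)) auto
      moreover have "integrable M (indicator {..s} :: 'a \<Rightarrow> real)" for s
        using M(2) by (intro integrable_real_indicator) (auto simp: emeasure_eq_measure)
      ultimately show ?thesis
        unfolding g_def h_def by (simp add: Bochner_Integration.integral_sum)
    qed
    then have "integral\<^sup>L P g - integral\<^sup>L N g =
        (\<Sum>s\<in>S. sgn (F s) * (measure P {..s} - integral\<^sup>L P (f s))) - (\<Sum>s\<in>S. sgn (F s) * (measure N {..s} - integral\<^sup>L N (f s)))"
      using fin by simp
    also have "\<dots> = (\<Sum>s\<in>S. sgn (F s) * (F s - (integral\<^sup>L P (f s) - integral\<^sup>L N (f s))))"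
    proof -
      have F_eq: "F s = measure P {..s} - measure N {..s}" for s
        using rep by (simp add: represents_def kmin_atLeastAtMost[OF K])
      show ?thesis unfolding sum_subtractf[symmetric]
        by (intro sum.cong refl) (simp add: F_eq algebra_simps)
    qed
    finally have "integral\<^sup>L P g - integral\<^sup>L N g = (\<Sum>s\<in>S. sgn (F s) * (F s - (integral\<^sup>L P (f s) - integral\<^sup>L N (f s))))" .
    \<comment> \<open>Termwise, \<open>sgn a * (a - b)\<close> is at least
      \<open>\<bar>a\<bar> - \<bar>b\<bar>\<close>, including the case \<open>a = 0\<close>.\<close>
    moreover have "(\<Sum>s\<in>S. \<bar>F s\<bar> - \<bar>integral\<^sup>L P (f s) - integral\<^sup>L N (f s)\<bar>) \<le>
        (\<Sum>s\<in>S. sgn (F s) * (F s - (integral\<^sup>L P (f s) - integral\<^sup>L N (f s))))"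
      by (intro sum_mono) (auto simp: sgn_if)
    ultimately show ?thesis using bound by (simp add: sum_subtractf)
  qed
  with f(1) that show ?thesis by blast
qed

theorem theorem2p28:
  fixes F :: "'i \<Rightarrow> 'a::linorder_topology \<Rightarrow> real" and I :: "'i set"
  assumes "compact_line TYPE('a)"
    and "\<forall>i\<in>I. F i \<in> NBV"
  shows "weak_star_null I F \<longleftrightarrow>
    ((\<exists>M. \<forall>i\<in>I. nbv_norm (F i) \<le> M) \<and>
     (\<forall>t. right_isolated t \<longrightarrow> c0_null I (\<lambda>i. F i t)) \<and>
     (\<exists>k\<ge>0. \<forall>S. finite S \<longrightarrow> le_mod_c0 I (\<lambda>i. \<Sum>t\<in>S. \<bar>F i t\<bar>) (\<lambda>i. k)))"
proof
  have K: "compact (UNIV :: 'a set)" using assms(1) by (simp add: compact_line_def)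
  {
    assume "weak_star_null I F"
    then obtain P N where rep: "\<And>i. i \<in> I \<Longrightarrow> represents (F i) (P i) (N i)"
      and null: "\<And>f::'a \<Rightarrow> real. continuous_on UNIV f \<Longrightarrow> c0_null I (\<lambda>i. integral\<^sup>L (P i) f - integral\<^sup>L (N i) f)"
      unfolding weak_star_null_def by blast
    obtain M where M: "\<And>i. i \<in> I \<Longrightarrow> nbv_norm (F i) \<le> M"
      using weak_star_null_nbv_bounded[OF K rep null] by blast
    have b: "c0_null I (\<lambda>i. F i t)" if "right_isolated t" for t
    proof -
      have "integral\<^sup>L (P i) (indicator {..t}) - integral\<^sup>L (N i) (indicator {..t}) = F i t" if "i \<in> I" for i
        using rep[OF that] represents_finite_measure(3,4)[OF rep[OF that], THEN sets_eq_imp_space_eq]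
        by (simp add: represents_def kmin_atLeastAtMost[OF K])
      then show ?thesis
        using null[OF continuous_indicator_right_isolated[OF that]] by (simp add: c0_null_def cong: conj_cong)
    qed
    \<comment> \<open>The norm bound itself serves as \<open>k\<close>, whatever \<open>S\<close>
      is; the absolute value only secures \<open>0 \<le> k\<close>.\<close>
    have c: "le_mod_c0 I (\<lambda>i. \<Sum>t\<in>S. \<bar>F i t\<bar>) (\<lambda>i. \<bar>M\<bar>)" if S: "finite S" for S
      unfolding le_mod_c0_def
    proof (intro allI impI)
      fix e :: real assume "0 < e"
      obtain f :: "'a \<Rightarrow> 'a \<Rightarrow> real" where f: "\<And>s. continuous_on UNIV (f s)"
        "\<And>F P (N :: 'a measure). represents F P N \<Longrightarrow> bounded_variation F \<Longrightarrow>
          (\<Sum>s\<in>S. \<bar>F s\<bar>) \<le> nbv_norm F + (\<Sum>s\<in>S. \<bar>integral\<^sup>L P (f s) - integral\<^sup>L N (f s)\<bar>)"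
        using sum_abs_le_nbv_norm[OF K S] by blast
      have "c0_null I (\<lambda>i. \<Sum>s\<in>S. \<bar>integral\<^sup>L (P i) (f s) - integral\<^sup>L (N i) (f s)\<bar>)"
        using null[OF f(1)] by (intro c0_null_sum S) (simp add: c0_null_def)
      then have "finite {i\<in>I. e \<le> \<bar>\<Sum>s\<in>S. \<bar>integral\<^sup>L (P i) (f s) - integral\<^sup>L (N i) (f s)\<bar>\<bar>}"
        using \<open>0 < e\<close> by (simp only: c0_null_def)
      \<comment> \<open>Since the norm accounts for at most \<open>\<bar>M\<bar>\<close>, the excess
        \<open>e\<close> must come from the integrals, and these form a null family.\<close>
      moreover have "e \<le> \<bar>\<Sum>s\<in>S. \<bar>integral\<^sup>L (P i) (f s) - integral\<^sup>L (N i) (f s)\<bar>\<bar>"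
        if "i \<in> I" "\<bar>M\<bar> + e \<le> (\<Sum>t\<in>S. \<bar>F i t\<bar>)" for i
        using f(2)[OF rep[OF that(1)]] M[OF that(1)] that assms(2) by (auto simp: NBV_def)
      then have "{i\<in>I. \<bar>M\<bar> + e \<le> (\<Sum>t\<in>S. \<bar>F i t\<bar>)} \<subseteq>
          {i\<in>I. e \<le> \<bar>\<Sum>s\<in>S. \<bar>integral\<^sup>L (P i) (f s) - integral\<^sup>L (N i) (f s)\<bar>\<bar>}" by blast
      ultimately show "finite {i\<in>I. \<bar>M\<bar> + e \<le> (\<Sum>t\<in>S. \<bar>F i t\<bar>)}"
        by (rule finite_subset[rotated])
    qed
    show "(\<exists>M. \<forall>i\<in>I. nbv_norm (F i) \<le> M) \<and>
     (\<forall>t. right_isolated t \<longrightarrow> c0_null I (\<lambda>i. F i t)) \<and>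
     (\<exists>k\<ge>0. \<forall>S. finite S \<longrightarrow> le_mod_c0 I (\<lambda>i. \<Sum>t\<in>S. \<bar>F i t\<bar>) (\<lambda>i. k))"
      using M b c abs_ge_zero by blast
  next
    assume "(\<exists>M. \<forall>i\<in>I. nbv_norm (F i) \<le> M) \<and>
     (\<forall>t. right_isolated t \<longrightarrow> c0_null I (\<lambda>i. F i t)) \<and>
     (\<exists>k\<ge>0. \<forall>S. finite S \<longrightarrow> le_mod_c0 I (\<lambda>i. \<Sum>t\<in>S. \<bar>F i t\<bar>) (\<lambda>i. k))"
    then obtain M k where "\<forall>i\<in>I. nbv_norm (F i) \<le> M" "\<forall>t. right_isolated t \<longrightarrow> c0_null I (\<lambda>i. F i t)"
      "0 \<le> k" "\<forall>S. finite S \<longrightarrow> le_mod_c0 I (\<lambda>i. \<Sum>t\<in>S. \<bar>F i t\<bar>) (\<lambda>i. k)"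
      by (elim conjE exE)
    then show "weak_star_null I F"
      using assms(2) by (intro weak_star_nullI[OF K, of I F M k]) simp_all
  }
qed

end
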